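(* Suppose the fine structure assumption, (for every $k\in\mathcal I$) the coarse structure assumption and the nonsmooth primal-dual coherence condition, and the parameter assumption stated in the context hold. Suppose $\hat U:=[\partial\bar G+\nabla\bar E+\Xi]^{-1}(0)\ne\emptyset$. Then for any initial $u^0\in U$ the sequence $\{u^k\}_{k\in\mathbb N}$ generated by the PDMCC algorithm is quasi-Fejér monotone with respect to $\hat U$, and converges weakly to some $\hat u\in\hat U$.
   Context: $\mathbb L(A;B)$ denotes the bounded linear operators from $A$ to $B$; $\overline{\mathbb R}=[-\infty,+\infty]$; $\partial$ is the convex subdifferential, $(\cdot)^*$ on functions is the Fenchel conjugate and on operators the adjoint; $f'(u;d)$ is the (one-sided) directional derivative; $\|u\|_A:=\sqrt{\langle Au,u\rangle}$ for self-adjoint positive semi-definite $A$. Fine structure assumption: $X,Y$ are Hilbert spaces, $U=X\times Y$; $F,E:X\to\overline{\mathbb R}$ and $G:Y\to\overline{\mathbb R}$ are proper, convex and lower semicontinuous, $E$ is differentiable on $X$ with $L$-Lipschitz gradient, $K\in\mathbb L(X;Y)$, and $\tau,\sigma>0$ satisfy $\tau L+\tau\sigma\|K\|^2<1$. For $u=(x,y)\in U$: $\bar G(u):=F(x)+G^*(y)$, $\bar E(u):=E(x)$, $$M=\begin{pmatrix}\tau^{-1}\mathrm{Id}&-K^*\\-K&\sigma^{-1}\mathrm{Id}\end{pmatrix},\ \Xi=\begin{pmatrix}0&K^*\\-K&0\end{pmatrix},\ \Lambda=\begin{pmatrix}L\,\mathrm{Id}&0\\0&0\end{pmatrix},\ Z=\begin{pmatrix}\tau^{-1}\mathrm{Id}&-2K^*\\0&\sigma^{-1}\mathrm{Id}\end{pmatrix},\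 W=\frac1CZZ^*,$$ with $C:=(1-\sqrt{\tau\sigma}\|K\|)\min\{\tau^{-1},\sigma^{-1}\}>0$. Let $\Phi(u;\hat u):=\bar G(u)+\bar E(u)+\langle\Xi\hat u,u\rangle$. $\hat u\in[\partial\bar G+\nabla\bar E+\Xi]^{-1}(0)$ means $0\in\partial\bar G(\hat u)+\nabla\bar E(\hat u)+\Xi\hat u$ (primal-dual solutions of $\min_xF(x)+E(x)+G(Kx)$). Quasi-Fejér monotonicity with respect to $\hat U$: for every $\hat u\in\hat U$ there is a summable non-negative sequence $\{\tilde\gamma_{k+1}\}_{k\in\mathbb N}$ with $\|u^{k+1}-\hat u\|_M^2\le\|u^k-\hat u\|_M^2+\tilde\gamma_{k+1}$ for all $k\ge0$. Coarse objects: $X_H,Y_H$ are Hilbert spaces, $U_H=X_H\times Y_H$ with elements $v=(\zeta,\xi)$; $P_h^H\in\mathbb L(X;X_H)$, $D_h^H\in\mathbb L(Y;Y_H)$, $I_h^H(x,y):=(P_h^Hx,D_h^Hy)$, $I_H^h:=(I_h^H)^*$. Coarse structure assumption: $E_H:X_H\to\mathbb R$, $F_H^k:X_H\to\overline{\mathbb R}$, $G_H^k:Y_H\to\overline{\mathbb R}$ are proper, convex and lower semicontinuous, $E_H$ is differentiable with $L_H$-Lipschitz gradient, $K_H\in\mathbb L(X_H;Y_H)$, and $\tau_H,\sigma_H>0$ satisfy $\tau_HL_H+\tau_H\sigma_H\|K_H\|^2<1$. Write $\bar G_H^k(v):=F_H^k(\zeta)+(G_H^k)^*(\xi)$, $\bar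 E_H(v):=E_H(\zeta)$, $$M_H=\begin{pmatrix}\tau_H^{-1}\mathrm{Id}&-K_H^*\\-K_H&\sigma_H^{-1}\mathrm{Id}\end{pmatrix},\quad \Xi_H=\begin{pmatrix}0&K_H^*\\-K_H&0\end{pmatrix}.$$ Coherence condition (at $k$): $I_h^H\partial\bar G(u_+^k)\subset\partial\bar G_H^k(v^{k,0})$, where $v^{k,0}:=I_h^Hu_+^k$. Parameter assumption: $\{\varepsilon_k\}_{k\in\mathcal I},\{\rho_k\}_{k\in\mathcal I}\subset(0,\infty)$ satisfy $\sum_{k\in\mathcal I}\varepsilon_k<\infty$, $\sum_{k\in\mathcal I}\rho_k<\infty$ and $\prod_{k\in\mathcal I}(1+\varepsilon_k)<\infty$. PDMCC algorithm: fix $\kappa\in(0,1)$, $m\ge1$, $\vartheta\in\{0,1\}$ and a trigger condition; $\mathcal I\subset\mathbb N$ is the set of iterations at which the (arbitrary) trigger condition holds. From $u^0\in U$, for each $k\in\mathbb N$, with $u^k=(x^k,y^k)$: 1. $u_+^k=(x_+^k,y_+^k)$ with $x_+^k:=\mathrm{prox}_{\tau F}(x^k-\tau(\nabla E(x^k)+K^*y^k))$, $y_+^k:=\mathrm{prox}_{\sigma G^*}(y^k+\sigma K(2x_+^k-x^k))$. 2. If $k\notin\mathcal I$, set $u^{k+1}:=u_+^k$. 3. If $k\in\mathcal I$: with $s_H^k:=I_h^H(\nabla\bar E(u_+^k)+\Xi u_+^k)-\nabla\bar E_H(v^{k,0})$, for $j=0,\ldots,m-1$ determine $v^{k,j+1}$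 from $$0\in\partial\bar G_H^k(v^{k,j+1})+\Xi_H(v^{k,j+1}-v_\vartheta^j)+\nabla\bar E_H(v^{k,j})+s_H^k+M_H(v^{k,j+1}-v^{k,j}),\quad v_\vartheta^j:=(1-\vartheta)v^{k,j}+\vartheta v^{k,0};$$ let $\tilde v^{k,m}:=\frac1m\sum_{j=0}^{m-1}v^{k,j+1}$ if $\vartheta=1$, $\tilde v^{k,m}:=v^{k,m}$ if $\vartheta=0$; set $d^k:=I_H^h(\tilde v^{k,m}-v^{k,0})$ and $u^{k+1}:=u_+^k+\theta_kd^k$, where $\theta=\theta_k\ge0$ satisfies either $$\Phi^k(u_+^k+\theta d^k)+\tfrac12\|\theta d^k\|_M^2+\tfrac1{2\varepsilon_k}\|\theta d^k\|_W^2\le\Phi^k(u_+^k)+\kappa\theta[\Phi^k]'(u_+^k;d^k)+\tfrac{\rho_k}2$$ or $$\Psi^k(u_+^k+\theta d^k)+\tfrac12\|\theta d^k\|_{M+\Lambda}^2+\tfrac1{2\varepsilon_k}\|\theta d^k\|_W^2\le\Psi^k(u_+^k)+\kappa\theta[\Psi^k]'(u_+^k;d^k)+\tfrac{\rho_k}2,$$ with $\Phi^k(u):=\Phi(u;u_+^k)$ and $\Psi^k(u):=\bar G(u)+\bar E(u_+^k)+\langle\nabla\bar E(u_+^k),u-u_+^k\rangle+\langle\Xi u_+^k,u\rangle$. If $v^{k,0}$ already solves the coarse problem, i.e. $0\in\partial\bar G_H^k(v^{k,0})+\nabla\bar E_H(v^{k,0})+s_H^k$, the correction is rejected: $d^k=0$,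 $\theta_k=0$.
   Formalization: The line-search inequality is required to hold with finite left-hand side, i.e. the new point has finite Φ^k (or Ψ^k) value; if the directional derivative is +∞ it would otherwise read ∞ ≤ ∞, accept every step length, and the claim would fail. *)

theory Defs
  imports "HOL-Analysis.Analysis"
begin

text \<open>
  Real Hilbert spaces are types of sort \<open>{real_inner, complete_space}\<close>; the product type carries
  the inner product of the Hilbert sum.  Bounded linear operators are of type \<open>'x \<Rightarrow>\<^sub>L 'y\<close>, and operators
  on the product space are plain functions on pairs.
\<close>

section \<open>Convex analysis for extended-real-valued functions\<close>

definition proper_fun :: "('a \<Rightarrow> ereal) \<Rightarrow> bool" where
  "proper_fun f \<longleftrightarrow> (\<forall>x. f x \<noteq> -\<infinity>) \<and> (\<exists>x. f x \<noteq> \<infinity>)"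

definition convex_fun :: "('a::real_vector \<Rightarrow> ereal) \<Rightarrow> bool" where
  "convex_fun f \<longleftrightarrow> (\<forall>x y t. 0 < t \<longrightarrow> t < 1 \<longrightarrow>
     f ((1 - t) *\<^sub>R x + t *\<^sub>R y) \<le> ereal (1 - t) * f x + ereal t * f y)"

definition lsc_fun :: "('a::topological_space \<Rightarrow> ereal) \<Rightarrow> bool" where
  "lsc_fun f \<longleftrightarrow> (\<forall>x. f x \<le> Liminf (at x) f)"

definition proper_convex_lsc :: "('a::real_normed_vector \<Rightarrow> ereal) \<Rightarrow> bool" where
  "proper_convex_lsc f \<longleftrightarrow> proper_fun f \<and> convex_fun f \<and> lsc_fun f"

definition subdiff :: "('a::real_inner \<Rightarrow> ereal) \<Rightarrow> 'a \<Rightarrow> 'a set" where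
  "subdiff f x = {g. \<bar>f x\<bar> \<noteq> \<infinity> \<and> (\<forall>y. f x + ereal (inner g (y - x)) \<le> f y)}"

definition fenchel_conjugate :: "('a::real_inner \<Rightarrow> ereal) \<Rightarrow> 'a \<Rightarrow> ereal" where
  "fenchel_conjugate f y = (SUP x. ereal (inner y x) - f x)"

definition prox :: "('a::real_inner \<Rightarrow> ereal) \<Rightarrow> 'a \<Rightarrow> 'a" where
  "prox f x = (ARG_MIN (\<lambda>z. f z + ereal ((norm (z - x))\<^sup>2 / 2)) z. True)"

text \<open>Differentiability on the whole space includes finiteness everywhere.\<close>

definition differentiable_fun :: "('a::real_inner \<Rightarrow> ereal) \<Rightarrow> bool" where
  "differentiable_fun f \<longleftrightarrow>
     (\<forall>x. \<bar>f x\<bar> \<noteq> \<infinity>) \<and> (\<forall>x. \<exists>D. GDERIV (\<lambda>z. real_of_ereal (f z)) x :> D)"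

definition gradient :: "('a::real_inner \<Rightarrow> ereal) \<Rightarrow> 'a \<Rightarrow> 'a" where
  "gradient f x = (THE D. GDERIV (\<lambda>z. real_of_ereal (f z)) x :> D)"

text \<open>One-sided directional derivative, as a limit in the extended reals.\<close>

definition dir_deriv :: "('a::real_vector \<Rightarrow> ereal) \<Rightarrow> 'a \<Rightarrow> 'a \<Rightarrow> ereal" where
  "dir_deriv f u d = Lim (at_right (0::real)) (\<lambda>t. (f (u + t *\<^sub>R d) - f u) / ereal t)"

definition op_norm :: "('a::real_inner \<Rightarrow> 'a) \<Rightarrow> 'a \<Rightarrow> real" where
  "op_norm A u = sqrt (inner (A u) u)"

definition weakly_converges :: "(nat \<Rightarrow> 'a::real_normed_vector) \<Rightarrow> 'a \<Rightarrow> bool" where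
  "weakly_converges u l \<longleftrightarrow>
     (\<forall>\<phi> :: 'a \<Rightarrow>\<^sub>L real. (\<lambda>k. blinfun_apply \<phi> (u k)) \<longlonglongrightarrow> blinfun_apply \<phi> l)"

definition quasi_fejer :: "('a::real_inner \<Rightarrow> 'a) \<Rightarrow> 'a set \<Rightarrow> (nat \<Rightarrow> 'a) \<Rightarrow> bool" where
  "quasi_fejer A S u \<longleftrightarrow>
     (\<forall>uhat\<in>S. \<exists>\<gamma> :: nat \<Rightarrow> real.
        (\<forall>k. 0 \<le> \<gamma> (Suc k)) \<and> summable (\<lambda>k. \<gamma> (Suc k)) \<and>
        (\<forall>k. (op_norm A (u (Suc k) - uhat))\<^sup>2 \<le> (op_norm A (u k - uhat))\<^sup>2 + \<gamma> (Suc k)))"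

section \<open>Primal-dual problem structure\<close>

definition Gbar ::
  "('x \<Rightarrow> ereal) \<Rightarrow> ('y::real_inner \<Rightarrow> ereal) \<Rightarrow> 'x \<times> 'y \<Rightarrow> ereal" where
  "Gbar F G = (\<lambda>(x, y). F x + fenchel_conjugate G y)"

definition Ebar :: "('x \<Rightarrow> ereal) \<Rightarrow> 'x \<times> 'y \<Rightarrow> ereal" where
  "Ebar E = (\<lambda>(x, y). E x)"

definition op_M ::
  "real \<Rightarrow> real \<Rightarrow> ('x::real_inner \<Rightarrow>\<^sub>L 'y::real_inner) \<Rightarrow> 'x \<times> 'y \<Rightarrow> 'x \<times> 'y" where
  "op_M \<tau> \<sigma> K = (\<lambda>(x, y). ((1 / \<tau>) *\<^sub>R x - adjoint (blinfun_apply K) y,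
                            - blinfun_apply K x + (1 / \<sigma>) *\<^sub>R y))"

definition op_Xi :: "('x::real_inner \<Rightarrow>\<^sub>L 'y::real_inner) \<Rightarrow> 'x \<times> 'y \<Rightarrow> 'x \<times> 'y" where
  "op_Xi K = (\<lambda>(x, y). (adjoint (blinfun_apply K) y, - blinfun_apply K x))"

definition op_Lambda :: "real \<Rightarrow> 'x::real_inner \<times> 'y::real_inner \<Rightarrow> 'x \<times> 'y" where
  "op_Lambda L = (\<lambda>(x, y). (L *\<^sub>R x, 0))"

definition op_Z ::
  "real \<Rightarrow> real \<Rightarrow> ('x::real_inner \<Rightarrow>\<^sub>L 'y::real_inner) \<Rightarrow> 'x \<times> 'y \<Rightarrow> 'x \<times> 'y" where
  "op_Z \<tau> \<sigma> K = (\<lambda>(x, y). ((1 / \<tau>) *\<^sub>R x - 2 *\<^sub>R adjoint (blinfun_apply K) y, (1 / \<sigma>) *\<^sub>R y))"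

definition const_C ::
  "real \<Rightarrow> real \<Rightarrow> ('x::real_inner \<Rightarrow>\<^sub>L 'y::real_inner) \<Rightarrow> real" where
  "const_C \<tau> \<sigma> K = (1 - sqrt (\<tau> * \<sigma>) * norm K) * min (1 / \<tau>) (1 / \<sigma>)"

definition op_W ::
  "real \<Rightarrow> real \<Rightarrow> ('x::real_inner \<Rightarrow>\<^sub>L 'y::real_inner) \<Rightarrow> 'x \<times> 'y \<Rightarrow> 'x \<times> 'y" where
  "op_W \<tau> \<sigma> K u = (1 / const_C \<tau> \<sigma> K) *\<^sub>R op_Z \<tau> \<sigma> K (adjoint (op_Z \<tau> \<sigma> K) u)"

text \<open>Used for both the fine and the coarse problem.  Note that \<open>lipschitz_on\<close> includes \<open>0 \<le> L\<close>.\<close>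

definition pd_structure ::
  "('x::{real_inner,complete_space} \<Rightarrow> ereal) \<Rightarrow> ('x \<Rightarrow> ereal) \<Rightarrow>
   ('y::{real_inner,complete_space} \<Rightarrow> ereal) \<Rightarrow> real \<Rightarrow> ('x \<Rightarrow>\<^sub>L 'y) \<Rightarrow> real \<Rightarrow> real \<Rightarrow> bool" where
  "pd_structure F E G L K \<tau> \<sigma> \<longleftrightarrow>
     proper_convex_lsc F \<and> proper_convex_lsc E \<and> proper_convex_lsc G \<and>
     differentiable_fun E \<and> L-lipschitz_on UNIV (gradient E) \<and>
     0 < \<tau> \<and> 0 < \<sigma> \<and> \<tau> * L + \<tau> * \<sigma> * (norm K)\<^sup>2 < 1"

definition pd_solutions ::
  "('x::real_inner \<Rightarrow> ereal) \<Rightarrow> ('x \<Rightarrow> ereal) \<Rightarrow> ('y::real_inner \<Rightarrow> ereal) \<Rightarrow> ('x \<Rightarrow>\<^sub>L 'y)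
   \<Rightarrow> ('x \<times> 'y) set" where
  "pd_solutions F E G K =
     {u. 0 \<in> (\<lambda>g. g + gradient (Ebar E) u + op_Xi K u) ` subdiff (Gbar F G) u}"

definition Phi ::
  "('x::real_inner \<Rightarrow> ereal) \<Rightarrow> ('x \<Rightarrow> ereal) \<Rightarrow> ('y::real_inner \<Rightarrow> ereal) \<Rightarrow> ('x \<Rightarrow>\<^sub>L 'y)
   \<Rightarrow> 'x \<times> 'y \<Rightarrow> 'x \<times> 'y \<Rightarrow> ereal" where
  "Phi F E G K uhat u = Gbar F G u + Ebar E u + ereal (inner (op_Xi K uhat) u)"

definition Psi ::
  "('x::real_inner \<Rightarrow> ereal) \<Rightarrow> ('x \<Rightarrow> ereal) \<Rightarrow> ('y::real_inner \<Rightarrow> ereal) \<Rightarrow> ('x \<Rightarrow>\<^sub>L 'y)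
   \<Rightarrow> 'x \<times> 'y \<Rightarrow> 'x \<times> 'y \<Rightarrow> ereal" where
  "Psi F E G K uhat u = Gbar F G u + Ebar E uhat
     + ereal (inner (gradient (Ebar E) uhat) (u - uhat)) + ereal (inner (op_Xi K uhat) u)"

section \<open>The algorithm\<close>

definition pdps_step ::
  "('x::real_inner \<Rightarrow> ereal) \<Rightarrow> ('x \<Rightarrow> ereal) \<Rightarrow> ('y::real_inner \<Rightarrow> ereal) \<Rightarrow> ('x \<Rightarrow>\<^sub>L 'y)
   \<Rightarrow> real \<Rightarrow> real \<Rightarrow> 'x \<times> 'y \<Rightarrow> 'x \<times> 'y" where
  "pdps_step F E G K \<tau> \<sigma> = (\<lambda>(x, y).
     let xp = prox (\<lambda>z. ereal \<tau> * F z)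
                (x - \<tau> *\<^sub>R (gradient E x + adjoint (blinfun_apply K) y));
         yp = prox (\<lambda>z. ereal \<sigma> * fenchel_conjugate G z)
                (y + \<sigma> *\<^sub>R blinfun_apply K (2 *\<^sub>R xp - x))
     in (xp, yp))"

definition restriction ::
  "('x::real_inner \<Rightarrow>\<^sub>L 'xh::real_inner) \<Rightarrow> ('y::real_inner \<Rightarrow>\<^sub>L 'yh::real_inner)
   \<Rightarrow> 'x \<times> 'y \<Rightarrow> 'xh \<times> 'yh" where
  "restriction P D = (\<lambda>(x, y). (blinfun_apply P x, blinfun_apply D y))"

definition coherent ::
  "('x::real_inner \<Rightarrow> ereal) \<Rightarrow> ('y::real_inner \<Rightarrow> ereal) \<Rightarrow>
   ('xh::real_inner \<Rightarrow> ereal) \<Rightarrow> ('yh::real_inner \<Rightarrow> ereal) \<Rightarrow>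
   ('x \<Rightarrow>\<^sub>L 'xh) \<Rightarrow> ('y \<Rightarrow>\<^sub>L 'yh) \<Rightarrow> 'x \<times> 'y \<Rightarrow> bool" where
  "coherent F G FH GH P D up \<longleftrightarrow>
     restriction P D ` subdiff (Gbar F G) up \<subseteq> subdiff (Gbar FH GH) (restriction P D up)"

definition coarse_shift ::
  "('x::real_inner \<Rightarrow> ereal) \<Rightarrow> ('x \<Rightarrow>\<^sub>L 'y::real_inner) \<Rightarrow> ('xh::real_inner \<Rightarrow> ereal) \<Rightarrow>
   ('x \<Rightarrow>\<^sub>L 'xh) \<Rightarrow> ('y \<Rightarrow>\<^sub>L 'yh::real_inner) \<Rightarrow> 'x \<times> 'y \<Rightarrow> 'xh \<times> 'yh" where
  "coarse_shift E K EH P D up =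
     restriction P D (gradient (Ebar E) up + op_Xi K up)
       - gradient (Ebar EH) (restriction P D up)"

definition coarse_solved ::
  "('xh::real_inner \<Rightarrow> ereal) \<Rightarrow> ('xh \<Rightarrow> ereal) \<Rightarrow> ('yh::real_inner \<Rightarrow> ereal) \<Rightarrow>
   'xh \<times> 'yh \<Rightarrow> 'xh \<times> 'yh \<Rightarrow> bool" where
  "coarse_solved FH EH GH s v0 \<longleftrightarrow>
     0 \<in> (\<lambda>g. g + gradient (Ebar EH) v0 + s) ` subdiff (Gbar FH GH) v0"

definition coarse_steps ::
  "('xh::real_inner \<Rightarrow> ereal) \<Rightarrow> ('xh \<Rightarrow> ereal) \<Rightarrow> ('yh::real_inner \<Rightarrow> ereal) \<Rightarrow>
   ('xh \<Rightarrow>\<^sub>L 'yh) \<Rightarrow> real \<Rightarrow> real \<Rightarrow> nat \<Rightarrow> real \<Rightarrow> 'xh \<times> 'yh \<Rightarrow> (nat \<Rightarrow> 'xh \<times> 'yh) \<Rightarrow> bool" where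
  "coarse_steps FH EH GH KH \<tau>H \<sigma>H m vartheta s v \<longleftrightarrow>
     (\<forall>j<m. 0 \<in> (\<lambda>g. g + op_Xi KH (v (Suc j) - ((1 - vartheta) *\<^sub>R v j + vartheta *\<^sub>R v 0))
                       + gradient (Ebar EH) (v j) + s + op_M \<tau>H \<sigma>H KH (v (Suc j) - v j))
               ` subdiff (Gbar FH GH) (v (Suc j)))"

definition coarse_output :: "nat \<Rightarrow> real \<Rightarrow> (nat \<Rightarrow> 'a::real_vector) \<Rightarrow> 'a" where
  "coarse_output m vartheta v = (if vartheta = 1 then (1 / real m) *\<^sub>R (\<Sum>j<m. v (Suc j)) else v m)"

text \<open>
  The sufficient-decrease condition is an inequality in which the left-hand side is finite, i.e. the
  new point lies in the effective domain of \<open>f\<close>.  This only matters if the directional derivative is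
  \<open>\<infinity>\<close> (so that \<open>f\<close> is \<open>\<infinity>\<close> along the whole open ray): then, with the conventions of \<open>ereal\<close>, both
  sides would be \<open>\<infinity>\<close> and every step length \<open>\<theta> > 0\<close> would be accepted vacuously.
\<close>

definition sufficient_decrease ::
  "('a::real_inner \<Rightarrow> ereal) \<Rightarrow> ('a \<Rightarrow> 'a) \<Rightarrow> ('a \<Rightarrow> 'a) \<Rightarrow> real \<Rightarrow> real \<Rightarrow> real
   \<Rightarrow> 'a \<Rightarrow> 'a \<Rightarrow> real \<Rightarrow> bool" where
  "sufficient_decrease f A W \<epsilon> \<rho> \<kappa> up d \<theta> \<longleftrightarrow>
     f (up + \<theta> *\<^sub>R d) < \<infinity> \<and>
     f (up + \<theta> *\<^sub>R d) + ereal ((op_norm A (\<theta> *\<^sub>R d))\<^sup>2 / 2)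
         + ereal ((op_norm W (\<theta> *\<^sub>R d))\<^sup>2 / (2 * \<epsilon>))
       \<le> f up + ereal (\<kappa> * \<theta>) * dir_deriv f up d + ereal (\<rho> / 2)"

text \<open>
  \<open>pdmcc \<dots> I u0 u v d \<theta>\<close>: the sequence \<open>u\<close> is generated from \<open>u0\<close>, with coarse inner iterates \<open>v k j\<close>,
  directions \<open>d k\<close> and step lengths \<open>\<theta> k\<close>.  The set \<open>I\<close> of iterations at which the trigger condition
  holds is arbitrary.
\<close>

definition pdmcc ::
  "('x::real_inner \<Rightarrow> ereal) \<Rightarrow> ('x \<Rightarrow> ereal) \<Rightarrow> ('y::real_inner \<Rightarrow> ereal) \<Rightarrow>
   real \<Rightarrow> ('x \<Rightarrow>\<^sub>L 'y) \<Rightarrow> real \<Rightarrow> real \<Rightarrow>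
   (nat \<Rightarrow> 'xh::real_inner \<Rightarrow> ereal) \<Rightarrow> ('xh \<Rightarrow> real) \<Rightarrow> (nat \<Rightarrow> 'yh::real_inner \<Rightarrow> ereal) \<Rightarrow>
   ('xh \<Rightarrow>\<^sub>L 'yh) \<Rightarrow> real \<Rightarrow> real \<Rightarrow>
   ('x \<Rightarrow>\<^sub>L 'xh) \<Rightarrow> ('y \<Rightarrow>\<^sub>L 'yh) \<Rightarrow>
   (nat \<Rightarrow> real) \<Rightarrow> (nat \<Rightarrow> real) \<Rightarrow> real \<Rightarrow> nat \<Rightarrow> real \<Rightarrow> nat set \<Rightarrow>
   'x \<times> 'y \<Rightarrow> (nat \<Rightarrow> 'x \<times> 'y) \<Rightarrow> (nat \<Rightarrow> nat \<Rightarrow> 'xh \<times> 'yh) \<Rightarrow> (nat \<Rightarrow> 'x \<times> 'y) \<Rightarrow> (nat \<Rightarrow> real)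
   \<Rightarrow> bool" where
  "pdmcc F E G L K \<tau> \<sigma> FH EH GH KH \<tau>H \<sigma>H P D \<epsilon> \<rho> \<kappa> m vartheta I u0 u v d \<theta> \<longleftrightarrow>
     u 0 = u0 \<and>
     (\<forall>k.
       let up = pdps_step F E G K \<tau> \<sigma> (u k);
           eEH = (\<lambda>z. ereal (EH z));
           s = coarse_shift E K eEH P D up;
           M = op_M \<tau> \<sigma> K;
           W = op_W \<tau> \<sigma> K
       in
         (k \<notin> I \<longrightarrow> u (Suc k) = up) \<and>
         (k \<in> I \<longrightarrow>
            v k 0 = restriction P D up \<and>
            (if coarse_solved (FH k) eEH (GH k) s (v k 0) then d k = 0 \<and> \<theta> k = 0
             else coarse_steps (FH k) eEH (GH k) KH \<tau>H \<sigma>H m vartheta s (v k) \<and>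
                  d k = adjoint (restriction P D) (coarse_output m vartheta (v k) - v k 0) \<and>
                  0 \<le> \<theta> k \<and>
                  (sufficient_decrease (Phi F E G K up) M W (\<epsilon> k) (\<rho> k) \<kappa> up (d k) (\<theta> k) \<or>
                   sufficient_decrease (Psi F E G K up) (\<lambda>w. M w + op_Lambda L w) W
                     (\<epsilon> k) (\<rho> k) \<kappa> up (d k) (\<theta> k))) \<and>
            u (Suc k) = up + \<theta> k *\<^sub>R d k))"

end

theory Submission
  imports Defs
begin

text \<open>
  The idea is to treat the corrected algorithm as a perturbation of a nonexpansive iteration and to
  show that the perturbations are summable.

  The uncorrected step \<open>T\<close> solves \<open>0 \<in> \<partial>Gbar(T u) + \<nabla>Ebar(u) + \<Xi> (T u) + M (T u - u)\<close>.  Comparing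
  two such inclusions by monotonicity, with \<open>\<Xi>\<close> skew and \<open>M - \<Lambda>\<close> coercive, shows that \<open>T\<close> is
  nonexpansive in the norm of \<open>M\<close>, and that a step decreases the squared distance to each solution by
  a multiple of \<open>\<parallel>T u - u\<parallel>\<^sup>2\<close> (lemma \<open>FB_nonexpansive\<close>); the fixed points of \<open>T\<close> are solutions.

  The same inclusion provides a subgradient \<open>\<nabla>Ebar(w) - \<nabla>Ebar(u) - M (w - u)\<close>, with \<open>w = T u\<close>, of
  either line-search function at \<open>w\<close>; its norm is at most a constant times \<open>\<parallel>w - u\<parallel>\<close>.  Convexity
  bounds the change of the line-search function from below by this subgradient and the directional
  derivative from above by the change.  Since \<open>\<kappa> \<le> 1\<close>, the term with \<open>W / \<epsilon>\<^sub>k\<close> then controls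
  the correction: its squared norm is \<open>O(\<epsilon>\<^sub>k (\<rho>\<^sub>k + \<epsilon>\<^sub>k \<parallel>w - u\<parallel>\<^sup>2))\<close>.  Young's inequality gives, for each
  solution \<open>p\<close> (lemma \<open>corrected_step_bound\<close>),
  \<open>\<parallel>u\<^sub>k\<^sub>+\<^sub>1 - p\<parallel>\<^sup>2 \<le> (1 + C \<epsilon>\<^sub>k) \<parallel>u\<^sub>k - p\<parallel>\<^sup>2 + C \<rho>\<^sub>k - c \<parallel>T u\<^sub>k - u\<^sub>k\<parallel>\<^sup>2\<close> in the norm of \<open>M\<close>.
  By Gronwall the distances are bounded, which turns the relative errors into summable absolute ones:
  the sequence is quasi-Fejer monotone, its distance to each solution has a limit, and
  \<open>T u\<^sub>k - u\<^sub>k\<close> tends to zero.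

  Weak convergence follows from these three properties by means of asymptotic centres (lemma
  \<open>weakly_converges_to_fixed_point\<close>): the point \<open>z\<close> that minimises the upper limit of
  \<open>\<parallel>u\<^sub>k - z\<parallel>\<^sup>2\<close> is unique, hence fixed by the nonexpansive map \<open>T\<close>, hence a solution; it is the same
  for all subsequences because the distances to solutions converge; and this forces the sequence to
  converge weakly to it.  Existence of the centre, of proximal points and of adjoints is in each case
  the existence of a minimiser of a strongly convex function.
\<close>

section \<open>Minimisers of strongly convex functions\<close>

lemma nonpos_if_le_quadratic:
  fixes a b :: real
  assumes "\<And>t. 0 < t \<Longrightarrow> t < 1 \<Longrightarrow> t * a \<le> t\<^sup>2 * b"
  shows "a \<le> 0"
proof (rule ccontr)
  assume "\<not> a \<le> 0"
  then have a: "a > 0" by simp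
  \<comment> \<open>For this \<open>t\<close> the quadratic term is at most half of the linear one.\<close>
  define t where "t = min (1/2) (a / (2 * (\<bar>b\<bar> + 1)))"
  have t: "0 < t" "t < 1" using a by (auto simp: t_def)
  have "t * a \<le> t * (t * b)" using assms[OF t] by (simp add: power2_eq_square)
  then have "a \<le> t * b" using t by simp
  also have "\<dots> \<le> t * (\<bar>b\<bar> + 1)" using t by (intro mult_left_mono) auto
  also have "\<dots> \<le> (a / (2 * (\<bar>b\<bar> + 1))) * (\<bar>b\<bar> + 1)"
    by (intro mult_right_mono) (auto simp: t_def)
  also have "\<dots> = a / 2" by (simp add: field_simps)
  finally show False using a by simp
qed

text \<open>
  Strong convexity forces minimising sequences to be Cauchy, and closed sublevel sets keep their
  limit minimal.  All existence results below (proximal points, the Riesz representation, asymptotic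
  centres) come from this lemma; the convexity hypothesis is phrased for real bounds on the values,
  the form in which it can be checked without extended-real arithmetic.
\<close>

lemma strongly_midconvex_attains_min:
  fixes f :: "'a::{real_normed_vector,complete_space} \<Rightarrow> ereal" and lb c :: real
  assumes mid: "\<And>x y a b. f x \<le> ereal a \<Longrightarrow> f y \<le> ereal b \<Longrightarrow>
      f (midpoint x y) \<le> ereal ((a + b) / 2 - c * (norm (x - y))\<^sup>2)"
    and c: "0 < c"
    and lower: "\<And>x. ereal lb \<le> f x"
    and dom: "f z < \<infinity>"
    and closed: "\<And>a. closed {x. f x \<le> ereal a}"
  shows "\<exists>p. \<forall>y. f p \<le> f y"
proof -
  define \<mu> where "\<mu> = (INF x. f x)"
  have "ereal lb \<le> \<mu>" unfolding \<mu>_def by (intro INF_greatest lower)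
  moreover have "\<mu> \<le> f z" unfolding \<mu>_def by (intro INF_lower) auto
  ultimately obtain i where i: "\<mu> = ereal i" using dom by (cases \<mu>) auto
  have il: "ereal i \<le> f x" for x unfolding i[symmetric] \<mu>_def by (intro INF_lower) auto
  have "\<exists>x. f x \<le> ereal (i + 1 / real (Suc n))" for n
  proof -
    have "\<mu> < ereal (i + 1 / real (Suc n))" unfolding i by simp
    then show ?thesis unfolding \<mu>_def by (auto simp: INF_less_iff intro: less_imp_le)
  qed
  then obtain X where X: "\<And>n. f (X n) \<le> ereal (i + 1 / real (Suc n))" by metis
  have near: "c * (norm (X n - X k))\<^sup>2 \<le> 1 / real (Suc N)" if "n \<ge> N" "k \<ge> N" for n k N
  proof -
    have solve_bound: "z \<le> (a + b) / 2" if "i \<le> ((i + a) + (i + b)) / 2 - z" for a b z :: real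
      using that by (simp add: field_simps)
    have "ereal i \<le> ereal (((i + 1 / real (Suc n)) + (i + 1 / real (Suc k))) / 2
         - c * (norm (X n - X k))\<^sup>2)"
      using mid[OF X X] il order_trans by blast
    then have "c * (norm (X n - X k))\<^sup>2 \<le> (1 / real (Suc n) + 1 / real (Suc k)) / 2"
      unfolding ereal_less_eq by (rule solve_bound)
    moreover have "1 / real (Suc n) \<le> 1 / real (Suc N)" "1 / real (Suc k) \<le> 1 / real (Suc N)"
      using that by (simp_all add: frac_le)
    ultimately show ?thesis by simp
  qed
  have "Cauchy X"
  proof (rule metric_CauchyI)
    fix e :: real assume e: "0 < e"
    obtain N where N: "1 / real (Suc N) < c * e\<^sup>2"
      using nat_approx_posE[of "c * e\<^sup>2"] c e by auto
    have "dist (X n) (X k) < e" if "n \<ge> N" "k \<ge> N" for n k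
    proof -
      have "c * (norm (X n - X k))\<^sup>2 < c * e\<^sup>2" using near[OF that] N by simp
      then have "(norm (X n - X k))\<^sup>2 < e\<^sup>2" using c by simp
      then show ?thesis using e by (simp add: dist_norm power2_less_imp_less)
    qed
    then show "\<exists>N. \<forall>n\<ge>N. \<forall>k\<ge>N. dist (X n) (X k) < e" by blast
  qed
  then obtain p where p: "X \<longlonglongrightarrow> p" using Cauchy_convergent convergent_def by blast
  have fp: "f p \<le> ereal (i + 1 / real (Suc N))" for N
  proof -
    have "eventually (\<lambda>n. X n \<in> {x. f x \<le> ereal (i + 1 / real (Suc N))}) sequentially"
    proof (rule eventually_sequentiallyI[of N])
      fix n assume "N \<le> n"
      then have "1 / real (Suc n) \<le> 1 / real (Suc N)" by (simp add: frac_le)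
      then have "ereal (i + 1 / real (Suc n)) \<le> ereal (i + 1 / real (Suc N))" by simp
      with X[of n] show "X n \<in> {x. f x \<le> ereal (i + 1 / real (Suc N))}"
        by (auto intro: order_trans)
    qed
    from Lim_in_closed_set[OF closed this _ p] show ?thesis by simp
  qed
  have "f p \<le> ereal i"
  proof (rule ereal_le_epsilon2)
    fix e :: real assume "0 < e"
    then obtain N where "1 / real (Suc N) < e" using nat_approx_posE by blast
    then have "ereal (i + 1 / real (Suc N)) \<le> ereal i + ereal e" by simp
    with fp[of N] show "f p \<le> ereal i + ereal e" by (rule order_trans)
  qed
  with il have "\<forall>y. f p \<le> f y" by (auto intro: order_trans)
  then show ?thesis ..
qed

section \<open>Equivalent inner products on a Hilbert space\<close>

text \<open>
  The convergence argument takes place in the geometry of the preconditioner of the algorithm, whereas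
  weak convergence and adjoints refer to the given inner product; the facts below serve both.
\<close>

locale equivalent_inner_product = bounded_bilinear B
  for B :: "'a::{real_inner,complete_space} \<Rightarrow> 'a \<Rightarrow> real" +
  fixes c :: real
  assumes sym: "B x y = B y x"
    and c_pos: "0 < c"
    and coercive: "c * (norm x)\<^sup>2 \<le> B x x"
begin

abbreviation sq :: "'a \<Rightarrow> real" where "sq x \<equiv> B x x"

lemma sq_nonneg: "0 \<le> sq x"
  using coercive[of x] c_pos by (meson mult_nonneg_nonneg less_imp_le order_trans zero_le_power2)

lemma sq_add: "sq (x + y) = sq x + 2 * B x y + sq y"
  by (simp add: add_left add_right sym[of y x])

lemma sq_diff: "sq (x - y) = sq x - 2 * B x y + sq y"
  by (simp add: diff_left diff_right sym[of y x])

lemma sq_scale: "sq (t *\<^sub>R x) = t\<^sup>2 * sq x"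
  by (simp add: scaleR_left scaleR_right power2_eq_square)

lemma sq_midpoint: "sq (u - midpoint x y) = (sq (u - x) + sq (u - y)) / 2 - sq (x - y) / 4"
proof -
  have "u - midpoint x y = (1/2) *\<^sub>R ((u - x) + (u - y))"
    by (simp add: midpoint_def algebra_simps flip: scaleR_2)
  then have "sq (u - midpoint x y) = (sq (u - x) + 2 * B (u - x) (u - y) + sq (u - y)) / 4"
    by (simp only: sq_scale sq_add[of "u - x" "u - y"]) (simp add: power2_eq_square)
  moreover have "sq (x - y) = sq (u - y) - 2 * B (u - y) (u - x) + sq (u - x)"
    using sq_diff[of "u - y" "u - x"] by simp
  ultimately show ?thesis by (simp add: sym[of "u - x" "u - y"] field_simps)
qed

lemma sq_upper: obtains C where "0 < C" "\<And>x. sq x \<le> C * (norm x)\<^sup>2"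
proof -
  obtain C where "0 < C" "\<And>x y. norm (B x y) \<le> norm x * norm y * C"
    using pos_bounded by blast
  then have "sq x \<le> C * (norm x)\<^sup>2" for x
    by (smt (verit) mult.commute mult.left_commute power2_eq_square real_norm_def)
  with \<open>0 < C\<close> show ?thesis using that by blast
qed

lemma sq_young:
  assumes "0 < \<epsilon>"
  shows "sq (x + y) \<le> (1 + \<epsilon>) * sq x + (1 + 1 / \<epsilon>) * sq y"
proof -
  have "0 \<le> sq (\<epsilon> *\<^sub>R x - y) / \<epsilon>" using assms sq_nonneg by simp
  also have "sq (\<epsilon> *\<^sub>R x - y) / \<epsilon> = \<epsilon> * sq x - 2 * B x y + sq y / \<epsilon>"
    unfolding sq_diff sq_scale scaleR_left scaleR_right using assms
    by (simp add: diff_divide_distrib add_divide_distrib power2_eq_square)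
  finally show ?thesis unfolding sq_add by (simp add: algebra_simps)
qed

text \<open>
  The representing element of \<open>\<phi>\<close> is the minimiser of \<open>\<lambda>z. sq z - 2 * \<phi> z\<close>.
\<close>

lemma riesz:
  assumes \<phi>: "bounded_linear \<phi>"
  shows "\<exists>p. \<forall>x. \<phi> x = B p x"
proof -
  interpret \<phi>: bounded_linear \<phi> by fact
  obtain N where N: "\<And>x. norm (\<phi> x) \<le> norm x * N" using \<phi>.pos_bounded by blast
  define f where "f z = sq z - 2 * \<phi> z" for z
  have low: "- N\<^sup>2 / c \<le> f z" for z
  proof -
    have "c * (norm z)\<^sup>2 - 2 * (norm z * N) \<le> f z"
      using coercive[of z] N[of z] unfolding f_def by (auto simp: abs_if split: if_splits)
    moreover have "0 \<le> (c * norm z - N)\<^sup>2 / c" using c_pos by simp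
    moreover have "(c * norm z - N)\<^sup>2 / c = c * (norm z)\<^sup>2 - 2 * (norm z * N) + N\<^sup>2 / c"
      using c_pos by (simp add: power2_diff field_simps power2_eq_square)
    ultimately show ?thesis by simp
  qed
  have fmid: "f (midpoint x y) = (f x + f y) / 2 - sq (x - y) / 4" for x y
  proof -
    have "sq (midpoint x y) = (sq x + sq y) / 2 - sq (x - y) / 4"
      using sq_midpoint[of 0 x y] by (simp add: minus_left minus_right)
    moreover have "\<phi> (midpoint x y) = (\<phi> x + \<phi> y) / 2"
      by (simp add: midpoint_def \<phi>.scaleR \<phi>.add)
    ultimately show ?thesis by (simp add: f_def field_simps)
  qed
  have cont: "continuous_on UNIV f"
    unfolding f_def by (intro continuous_intros continuous_on bounded_linear.continuous_on[OF \<phi>])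
  have "\<exists>p. \<forall>y. ereal (f p) \<le> ereal (f y)"
  proof (rule strongly_midconvex_attains_min[where c = "c / 4" and lb = "- N\<^sup>2 / c" and z = 0])
    fix x y a b assume "ereal (f x) \<le> ereal a" "ereal (f y) \<le> ereal b"
    then show "ereal (f (midpoint x y)) \<le> ereal ((a + b) / 2 - c / 4 * (norm (x - y))\<^sup>2)"
      using coercive[of "x - y"] by (simp add: fmid field_simps)
  next
    fix a :: real
    show "closed {x. ereal (f x) \<le> ereal a}"
      using closed_Collect_le[OF cont continuous_on_const[of UNIV a]] by simp
  qed (use c_pos low in auto)
  then obtain p where p: "\<And>y. f p \<le> f y" by auto
  have le: "\<phi> x - B p x \<le> 0" for x
  proof (rule nonpos_if_le_quadratic[where b = "sq x / 2"])
    fix t :: real assume "0 < t" "t < 1"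
    have "f p \<le> f (p + t *\<^sub>R x)" by (rule p)
    then show "t * (\<phi> x - B p x) \<le> t\<^sup>2 * (sq x / 2)"
      unfolding f_def sq_add sq_scale
      by (simp add: scaleR_right \<phi>.add \<phi>.scaleR algebra_simps)
  qed
  have "\<phi> x = B p x" for x
    using le[of x] le[of "- x"] by (simp add: \<phi>.neg minus_right)
  then show ?thesis by blast
qed

end

lemma adjoint_exists:
  fixes f :: "'a::{real_inner,complete_space} \<Rightarrow> 'b::real_inner"
  assumes f: "bounded_linear f"
  shows "inner (f x) y = inner x (adjoint f y)"
proof -
  interpret ip: equivalent_inner_product "inner :: 'a \<Rightarrow> 'a \<Rightarrow> real" 1
    by (intro equivalent_inner_product.intro equivalent_inner_product_axioms.intro
        bounded_bilinear_inner) (auto simp: inner_commute power2_norm_eq_inner)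
  have "\<exists>p. \<forall>x. inner (f x) y = inner p x" for y
    by (rule ip.riesz) (intro bounded_linear_compose[OF bounded_linear_inner_left f])
  then obtain g where g: "\<And>x y. inner (f x) y = inner (g y) x" by metis
  have "\<exists>f'. \<forall>x y. inner (f x) y = inner x (f' y)"
    by (rule exI[of _ g]) (use g in \<open>auto simp: inner_commute\<close>)
  then have "\<forall>x y. inner (f x) y = inner x (adjoint f y)"
    unfolding adjoint_def by (rule someI_ex)
  then show ?thesis by blast
qed

lemma bounded_linear_adjoint:
  fixes f :: "'a::{real_inner,complete_space} \<Rightarrow> 'b::real_inner"
  assumes f: "bounded_linear f"
  shows "bounded_linear (adjoint f)"
proof -
  obtain N where "0 \<le> N" and N: "\<And>x. norm (f x) \<le> norm x * N"
    using bounded_linear.nonneg_bounded[OF f] by blast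
  note adj = adjoint_exists[OF f]
  show ?thesis
  proof (rule bounded_linear_intro)
    fix x y and r :: real
    have "inner z (adjoint f (x + y)) = inner z (adjoint f x + adjoint f y)" for z
      by (simp add: adj[symmetric] inner_add_right)
    then show "adjoint f (x + y) = adjoint f x + adjoint f y" using vector_eq_rdot by (metis inner_commute)
    have "inner z (adjoint f (r *\<^sub>R x)) = inner z (r *\<^sub>R adjoint f x)" for z
      by (simp add: adj[symmetric])
    then show "adjoint f (r *\<^sub>R x) = r *\<^sub>R adjoint f x" using vector_eq_rdot by (metis inner_commute)
    have "(norm (adjoint f x))\<^sup>2 = inner (f (adjoint f x)) x"
      by (simp add: adj power2_norm_eq_inner)
    also have "\<dots> \<le> norm (f (adjoint f x)) * norm x" by (rule norm_cauchy_schwarz)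
    also have "\<dots> \<le> (norm (adjoint f x) * N) * norm x" by (intro mult_right_mono N) simp
    finally have "norm (adjoint f x) * norm (adjoint f x) \<le> norm (adjoint f x) * (norm x * N)"
      by (simp add: power2_eq_square mult_ac)
    then show "norm (adjoint f x) \<le> norm x * N" by (cases "adjoint f x = 0") (use \<open>0 \<le> N\<close> in auto)
  qed
qed

section \<open>Asymptotic centres and weak convergence\<close>

lemma Limsup_ereal_leI:
  assumes F: "F \<noteq> bot" and le: "\<And>\<eta>. 0 < \<eta> \<Longrightarrow> eventually (\<lambda>k. g k \<le> h k + \<eta>) F"
  shows "Limsup F (\<lambda>k. ereal (g k)) \<le> Limsup F (\<lambda>k. ereal (h k))"
proof (rule ereal_le_epsilon2)
  fix \<eta> :: real assume "0 < \<eta>"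
  then have "Limsup F (\<lambda>k. ereal (g k)) \<le> Limsup F (\<lambda>k. ereal (h k) + ereal \<eta>)"
    by (intro Limsup_mono) (use le in simp)
  also have "\<dots> = Limsup F (\<lambda>k. ereal (h k)) + ereal \<eta>"
    using F by (rule Limsup_add_ereal_right) simp
  finally show "Limsup F (\<lambda>k. ereal (g k)) \<le> Limsup F (\<lambda>k. ereal (h k)) + ereal \<eta>" .
qed

lemma eventually_less_of_Limsup_le:
  fixes a \<eta> :: real
  assumes "Limsup F (\<lambda>k. ereal (g k)) \<le> ereal a" "0 < \<eta>"
  shows "eventually (\<lambda>k. g k < a + \<eta>) F"
proof -
  have "ereal a < ereal (a + \<eta>)" using assms(2) by simp
  with assms(1) have "eventually (\<lambda>k. ereal (g k) < ereal (a + \<eta>)) F"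
    unfolding Limsup_le_iff by blast
  then show ?thesis by simp
qed

lemma Limsup_ereal_le_realI:
  fixes a :: real
  assumes F: "F \<noteq> bot" and "\<And>\<eta>. 0 < \<eta> \<Longrightarrow> eventually (\<lambda>k. g k \<le> a + \<eta>) F"
  shows "Limsup F (\<lambda>k. ereal (g k)) \<le> ereal a"
  using Limsup_ereal_leI[OF F, of g "\<lambda>_. a"] assms(2) Limsup_const[OF F, of "ereal a"] by simp

context equivalent_inner_product
begin

text \<open>
  The parallelogram identity survives the upper limit, so \<open>z \<mapsto> Limsup F (sq (s k - z))\<close> is
  strongly convex.  Arbitrary filters are allowed in order to treat a sequence and its subsequences
  alike.
\<close>

lemma asymptotic_centre:
  assumes F: "F \<noteq> bot" and bdd: "\<And>k. norm (s k) \<le> R"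
  shows "\<exists>p. \<forall>z. z \<noteq> p \<longrightarrow>
    Limsup F (\<lambda>k. ereal (sq (s k - p))) < Limsup F (\<lambda>k. ereal (sq (s k - z)))"
proof -
  define r where "r z = Limsup F (\<lambda>k. ereal (sq (s k - z)))" for z
  obtain C where C: "0 < C" "\<And>x. sq x \<le> C * (norm x)\<^sup>2" using sq_upper by blast
  obtain N where N: "0 < N" "\<And>x y. norm (B x y) \<le> norm x * norm y * N"
    using pos_bounded by blast
  have R: "0 \<le> R" using bdd norm_ge_zero order_trans by blast
  have mid: "r (midpoint x y) \<le> ereal ((a + b) / 2 - c / 4 * (norm (x - y))\<^sup>2)"
    if "r x \<le> ereal a" "r y \<le> ereal b" for x y a b
    unfolding r_def
  proof (rule Limsup_ereal_le_realI[OF F])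
    fix \<eta> :: real assume \<eta>: "0 < \<eta>"
    have "eventually (\<lambda>k. sq (s k - x) < a + \<eta>) F" "eventually (\<lambda>k. sq (s k - y) < b + \<eta>) F"
      using that \<eta> unfolding r_def by (auto intro: eventually_less_of_Limsup_le)
    then show "eventually (\<lambda>k. sq (s k - midpoint x y)
        \<le> (a + b) / 2 - c / 4 * (norm (x - y))\<^sup>2 + \<eta>) F"
      by eventually_elim (use coercive[of "x - y"] in \<open>simp add: sq_midpoint field_simps\<close>)
  qed
  have lower: "ereal 0 \<le> r x" for x
    unfolding r_def using F by (intro le_Limsup) (auto simp: sq_nonneg)
  have dom: "r 0 < \<infinity>"
  proof -
    have "r 0 \<le> ereal (C * R\<^sup>2)"
      unfolding r_def
    proof (intro Limsup_bounded always_eventually allI)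
      fix k
      have "sq (s k) \<le> C * (norm (s k))\<^sup>2" by (rule C)
      also have "\<dots> \<le> C * R\<^sup>2" using C bdd by (intro mult_left_mono power_mono) auto
      finally show "ereal (sq (s k - 0)) \<le> ereal (C * R\<^sup>2)" by simp
    qed
    then show ?thesis by (auto simp: less_le_trans intro: le_less_trans)
  qed
  have closed: "closed {x. r x \<le> ereal a}" for a
    unfolding closed_sequential_limits
  proof (intro allI impI, elim conjE)
    fix X x assume X: "\<forall>n. X n \<in> {x. r x \<le> ereal a}" and lim: "X \<longlonglongrightarrow> x"
    define e where "e n = 2 * ((R + norm (X n)) * norm (X n - x) * N) + sq (X n - x)" for n
    have "e \<longlonglongrightarrow> 2 * ((R + norm x) * norm (x - x) * N) + sq (x - x)"
      unfolding e_def by (intro tendsto_intros tendsto lim)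
    then have e: "e \<longlonglongrightarrow> 0" by (simp add: zero_left)
    have "r x \<le> ereal a" unfolding r_def
    proof (rule Limsup_ereal_le_realI[OF F])
      fix \<eta> :: real assume \<eta>: "0 < \<eta>"
      obtain n where n: "e n < \<eta> / 2"
        using order_tendstoD(2)[OF e, of "\<eta> / 2"] \<eta> eventually_sequentially by auto
      have "eventually (\<lambda>k. sq (s k - X n) < a + \<eta> / 2) F"
        using X \<eta> unfolding r_def by (intro eventually_less_of_Limsup_le) auto
      then show "eventually (\<lambda>k. sq (s k - x) \<le> a + \<eta>) F"
      proof eventually_elim
        fix k assume k: "sq (s k - X n) < a + \<eta> / 2"
        have "B (s k - X n) (X n - x) \<le> norm (s k - X n) * norm (X n - x) * N"
          using N(2)[of "s k - X n" "X n - x"] by simp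
        also have "\<dots> \<le> (R + norm (X n)) * norm (X n - x) * N"
          using N(1) norm_triangle_ineq4[of "s k" "X n"] bdd[of k]
          by (intro mult_right_mono) auto
        finally have "sq ((s k - X n) + (X n - x)) \<le> sq (s k - X n) + e n"
          unfolding sq_add[of "s k - X n"] e_def by simp
        with k n show "sq (s k - x) \<le> a + \<eta>" by simp
      qed
    qed
    then show "x \<in> {x. r x \<le> ereal a}" by simp
  qed
  obtain p where p: "\<And>z. r p \<le> r z"
    using strongly_midconvex_attains_min[OF mid _ lower dom closed] c_pos by auto
  have "r p < r z" if "z \<noteq> p" for z
  proof (rule ccontr)
    assume "\<not> r p < r z"
    then have "r z \<le> r p" by simp
    obtain a where a: "r p = ereal a"
      using p[of 0] dom lower[of p] by (cases "r p") auto
    have "ereal a \<le> ereal ((a + a) / 2 - c / 4 * (norm (p - z))\<^sup>2)"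
      using mid[of p a z a] p[of "midpoint p z"] \<open>r z \<le> r p\<close> unfolding a
      by (meson order_refl order_trans)
    then have "c * (norm (p - z))\<^sup>2 \<le> 0" by simp
    then show False using c_pos that by (simp add: mult_le_0_iff)
  qed
  then show ?thesis unfolding r_def by blast
qed

text \<open>
  The asymptotic centre of \<open>s\<close> along any filter is a fixed point of \<open>T\<close>: by nonexpansiveness \<open>T p\<close>
  does not have a larger value than the centre \<open>p\<close>, and the centre is unique.  At the points of \<open>S\<close>
  the distance to \<open>s\<close> has a limit, hence the centre is the same along the whole sequence and along
  each of its subsequences.  If \<open>s\<close> did not converge weakly to it, then along some subsequence a
  small move of the centre in the direction of an offending functional would decrease the upper
  limit.
\<close>

lemma weakly_converges_to_fixed_point:
  fixes T :: "'a \<Rightarrow> 'a" and s :: "nat \<Rightarrow> 'a"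
  assumes nonexp: "\<And>x y. sq (T x - T y) \<le> sq (x - y)"
    and regular: "(\<lambda>k. s k - T (s k)) \<longlonglongrightarrow> 0"
    and fixed: "\<And>x. T x = x \<Longrightarrow> x \<in> S"
    and conv: "\<And>p. p \<in> S \<Longrightarrow> convergent (\<lambda>k. sq (s k - p))"
    and bdd: "\<And>k. norm (s k) \<le> R"
  shows "\<exists>p\<in>S. weakly_converges s p"
proof -
  define r where "r F z = Limsup F (\<lambda>k. ereal (sq (s k - z)))" for F z
  obtain C where C: "0 < C" "\<And>x. sq x \<le> C * (norm x)\<^sup>2" using sq_upper by blast
  have reg: "(\<lambda>k. sq (s k - T (s k))) \<longlonglongrightarrow> 0"
    using tendsto[OF regular regular] by (simp add: zero_left)
  have centre: "\<exists>p\<in>S. \<forall>z. z \<noteq> p \<longrightarrow> r F p < r F z"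
    if F: "F \<noteq> bot" "F \<le> sequentially" for F
  proof -
    obtain p where p: "\<And>z. z \<noteq> p \<Longrightarrow> r F p < r F z"
      using asymptotic_centre[OF F(1), of s R] bdd unfolding r_def by blast
    have "r F (T p) \<le> r F p"
      unfolding r_def
    proof (rule Limsup_ereal_leI[OF F(1)])
      fix \<eta> :: real assume \<eta>: "0 < \<eta>"
      define A where "A = C * (R + norm p)\<^sup>2 + 1"
      have A: "sq (s k - p) \<le> A" for k
      proof -
        have "sq (s k - p) \<le> C * (norm (s k - p))\<^sup>2" by (rule C)
        also have "\<dots> \<le> C * (R + norm p)\<^sup>2"
          using C norm_triangle_ineq4[of "s k" p] bdd[of k]
          by (intro mult_left_mono power_mono) auto
        finally show ?thesis unfolding A_def by simp
      qed
      have A0: "0 < A" unfolding A_def using C by (auto intro: add_nonneg_pos)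
      \<comment> \<open>Young's inequality with this weight turns the bound \<open>A\<close> into an error \<open>\<eta> / 2\<close>.\<close>
      define \<nu> where "\<nu> = \<eta> / (2 * A)"
      have \<nu>: "0 < \<nu>" unfolding \<nu>_def using \<eta> A0 by simp
      have "(\<lambda>k. (1 + 1 / \<nu>) * sq (s k - T (s k))) \<longlonglongrightarrow> (1 + 1 / \<nu>) * 0"
        by (intro tendsto_intros reg)
      then have "eventually (\<lambda>k. (1 + 1 / \<nu>) * sq (s k - T (s k)) < \<eta> / 2) sequentially"
        using \<eta> by (intro order_tendstoD(2)[of _ 0]) auto
      then have "eventually (\<lambda>k. (1 + 1 / \<nu>) * sq (s k - T (s k)) < \<eta> / 2) F"
        using F(2) by (rule filter_leD[rotated])
      then show "eventually (\<lambda>k. sq (s k - T p) \<le> sq (s k - p) + \<eta>) F"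
      proof eventually_elim
        fix k assume k: "(1 + 1 / \<nu>) * sq (s k - T (s k)) < \<eta> / 2"
        have "sq ((T (s k) - T p) + (s k - T (s k)))
            \<le> (1 + \<nu>) * sq (T (s k) - T p) + (1 + 1 / \<nu>) * sq (s k - T (s k))"
          by (rule sq_young[OF \<nu>])
        also have "\<dots> \<le> (1 + \<nu>) * sq (s k - p) + \<eta> / 2"
          using k nonexp[of "s k" p] \<nu> by (intro add_mono mult_left_mono) auto
        also have "\<dots> \<le> sq (s k - p) + \<nu> * A + \<eta> / 2"
          using A[of k] \<nu> by (simp add: algebra_simps)
        also have "\<nu> * A = \<eta> / 2" unfolding \<nu>_def using A0 by simp
        finally show "sq (s k - T p) \<le> sq (s k - p) + \<eta>" by simp
      qed
    qed
    with p[of "T p"] have "T p = p" by (meson not_le)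
    then show ?thesis using fixed p by blast
  qed
  obtain p where pS: "p \<in> S" and p: "\<And>z. z \<noteq> p \<Longrightarrow> r sequentially p < r sequentially z"
    using centre[of sequentially] by auto
  have rF: "r F q = r sequentially q" if F: "F \<noteq> bot" "F \<le> sequentially" and q: "q \<in> S" for F q
  proof -
    obtain l where "(\<lambda>k. sq (s k - q)) \<longlonglongrightarrow> l" using conv[OF q] convergent_def by blast
    then have l: "(\<lambda>k. ereal (sq (s k - q))) \<longlonglongrightarrow> ereal l" by simp
    show ?thesis
      unfolding r_def using lim_imp_Limsup[OF _ l] lim_imp_Limsup[OF F(1) tendsto_mono[OF F(2) l]]
      by simp
  qed
  have less: "eventually (\<lambda>k. B z (s k - p) < \<delta>) sequentially" if \<delta>: "0 < \<delta>" for z \<delta>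
  proof (rule ccontr)
    assume n: "\<not> eventually (\<lambda>k. B z (s k - p) < \<delta>) sequentially"
    \<comment> \<open>The filter of the subsequence along which the bound fails.\<close>
    define F where "F = inf sequentially (principal {k. \<delta> \<le> B z (s k - p)})"
    have F: "F \<noteq> bot" "F \<le> sequentially"
      using n unfolding F_def trivial_limit_def eventually_inf_principal by (auto simp: not_le)
    obtain q where q: "q \<in> S" "\<And>z. z \<noteq> q \<Longrightarrow> r F q < r F z" using centre[OF F] by auto
    have "q = p" using p[of q] q(2)[of p] rF[OF F q(1)] rF[OF F pS] by (metis less_asym)
    obtain l where "(\<lambda>k. sq (s k - p)) \<longlonglongrightarrow> l" using conv[OF pS] convergent_def by blast
    then have "r sequentially p = ereal l"
      unfolding r_def by (intro lim_imp_Limsup) auto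
    then have l: "r F p = ereal l" using rF[OF F pS] by simp
    have "2 * \<delta> \<le> 0"
    proof (rule nonpos_if_le_quadratic)
      fix t :: real assume t: "0 < t" "t < 1"
      have "r F p \<le> r F (p + t *\<^sub>R z)"
        using q(2)[of "p + t *\<^sub>R z"] \<open>q = p\<close> by (cases "p + t *\<^sub>R z = p") (auto simp: less_imp_le)
      also have "r F (p + t *\<^sub>R z) \<le> Limsup F (\<lambda>k. ereal (sq (s k - p)) + ereal (t\<^sup>2 * sq z - t * (2 * \<delta>)))"
        unfolding r_def
      proof (rule Limsup_mono)
        have "eventually (\<lambda>k. \<delta> \<le> B z (s k - p)) F"
          unfolding F_def eventually_inf_principal by simp
        then show "eventually (\<lambda>k. ereal (sq (s k - (p + t *\<^sub>R z)))
            \<le> ereal (sq (s k - p)) + ereal (t\<^sup>2 * sq z - t * (2 * \<delta>))) F"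
        proof eventually_elim
          fix k assume "\<delta> \<le> B z (s k - p)"
          then have "t * \<delta> \<le> t * B z (s k - p)" using t by simp
          moreover have "sq ((s k - p) - t *\<^sub>R z) = sq (s k - p) - 2 * (t * B z (s k - p)) + t\<^sup>2 * sq z"
            unfolding sq_diff sq_scale by (simp add: scaleR_right sym[of "s k - p" z])
          ultimately show "ereal (sq (s k - (p + t *\<^sub>R z)))
            \<le> ereal (sq (s k - p)) + ereal (t\<^sup>2 * sq z - t * (2 * \<delta>))"
            by (simp add: diff_diff_eq mult.commute mult.left_commute)
        qed
      qed
      also have "\<dots> = r F p + ereal (t\<^sup>2 * sq z - t * (2 * \<delta>))"
        unfolding r_def using F(1) by (rule Limsup_add_ereal_right) simp
      finally show "t * (2 * \<delta>) \<le> t\<^sup>2 * sq z" unfolding l by simp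
    qed
    with \<delta> show False by simp
  qed
  have "weakly_converges s p"
    unfolding weakly_converges_def
  proof
    fix \<phi> :: "'a \<Rightarrow>\<^sub>L real"
    obtain z where z: "\<And>x. blinfun_apply \<phi> x = B z x"
      using riesz[OF blinfun.bounded_linear_right] by blast
    show "(\<lambda>k. blinfun_apply \<phi> (s k)) \<longlonglongrightarrow> blinfun_apply \<phi> p"
    proof (rule tendstoI)
      fix \<delta> :: real assume "0 < \<delta>"
      with less[of \<delta> z] less[of \<delta> "- z"]
      have "eventually (\<lambda>k. B z (s k - p) < \<delta>) sequentially"
        "eventually (\<lambda>k. B (- z) (s k - p) < \<delta>) sequentially" by auto
      then show "eventually (\<lambda>k. dist (blinfun_apply \<phi> (s k)) (blinfun_apply \<phi> p) < \<delta>) sequentially"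
        by eventually_elim (auto simp: z dist_norm diff_right minus_left)
    qed
  qed
  with pS show ?thesis by blast
qed

end

section \<open>Convex lower semicontinuous functions\<close>

lemma lsc_fun_iff:
  "lsc_fun f \<longleftrightarrow> (\<forall>x y. ereal y < f x \<longrightarrow> eventually (\<lambda>z. ereal y < f z) (nhds x))"
proof
  assume "lsc_fun f"
  then have "\<And>x y. y < f x \<Longrightarrow> eventually (\<lambda>z. y < f z) (at x)"
    unfolding lsc_fun_def le_Liminf_iff by blast
  then show "\<forall>x y. ereal y < f x \<longrightarrow> eventually (\<lambda>z. ereal y < f z) (nhds x)"
    by (auto simp: eventually_nhds_conv_at)
next
  assume R: "\<forall>x y. ereal y < f x \<longrightarrow> eventually (\<lambda>z. ereal y < f z) (nhds x)"
  show "lsc_fun f"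
    unfolding lsc_fun_def le_Liminf_iff
  proof (intro allI impI)
    fix x y assume "y < f x"
    then obtain w where w: "y < ereal w" "ereal w < f x" using ereal_dense2 by blast
    then have "eventually (\<lambda>z. ereal w < f z) (at x)"
      using R by (auto simp: eventually_nhds_conv_at)
    then show "eventually (\<lambda>z. y < f z) (at x)" by eventually_elim (use w in auto)
  qed
qed

lemma closed_sublevel_if_lsc:
  assumes "lsc_fun f" shows "closed {x. f x \<le> ereal a}"
proof -
  have "open {x. ereal a < f x}"
  proof (subst open_subopen, rule ballI)
    fix x assume "x \<in> {x. ereal a < f x}"
    then have "eventually (\<lambda>z. ereal a < f z) (nhds x)" using assms unfolding lsc_fun_iff by simp
    then show "\<exists>T. open T \<and> x \<in> T \<and> T \<subseteq> {x. ereal a < f x}"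
      unfolding eventually_nhds by auto
  qed
  moreover have "- {x. ereal a < f x} = {x. f x \<le> ereal a}" by auto
  ultimately show ?thesis by (metis closed_Compl)
qed

lemma lsc_fun_add_continuous:
  assumes f: "lsc_fun f" "\<And>x. f x \<noteq> -\<infinity>" and h: "continuous_on UNIV h"
  shows "lsc_fun (\<lambda>x. f x + ereal (h x))"
  unfolding lsc_fun_iff
proof (intro allI impI)
  fix x y assume y: "ereal y < f x + ereal (h x)"
  obtain w where w: "ereal w < f x" "y - w < h x"
  proof (cases "f x")
    case (real r)
    then show ?thesis using y that[of "(r + y - h x) / 2"] by (simp add: field_simps)
  next
    case PInf
    then show ?thesis using that[of "y - h x + 1"] by simp
  qed (use f(2) in auto)
  have "eventually (\<lambda>z. ereal w < f z) (nhds x)" using f(1) w(1) unfolding lsc_fun_iff by blast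
  moreover have "(h \<longlongrightarrow> h x) (at x)" using h by (simp add: continuous_on_def)
  then have "(h \<longlongrightarrow> h x) (nhds x)" unfolding tendsto_at_iff_tendsto_nhds .
  then have "eventually (\<lambda>z. y - w < h z) (nhds x)" using w(2) by (rule order_tendstoD)
  ultimately show "eventually (\<lambda>z. ereal y < f z + ereal (h z)) (nhds x)"
  proof eventually_elim
    case (elim z)
    then show ?case by (cases "f z") auto
  qed
qed

lemma convex_funD:
  assumes "convex_fun f" "0 < t" "t < 1" "f x \<le> ereal a" "f y \<le> ereal b"
  shows "f ((1 - t) *\<^sub>R x + t *\<^sub>R y) \<le> ereal ((1 - t) * a + t * b)"
proof -
  have "f ((1 - t) *\<^sub>R x + t *\<^sub>R y) \<le> ereal (1 - t) * f x + ereal t * f y"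
    using assms unfolding convex_fun_def by blast
  also have "\<dots> \<le> ereal (1 - t) * ereal a + ereal t * ereal b"
    using assms by (intro add_mono ereal_mult_left_mono) auto
  finally show ?thesis by simp
qed

lemma convex_funI:
  assumes ninf: "\<And>x. f x \<noteq> -\<infinity>"
    and cv: "\<And>x y a b t. f x = ereal a \<Longrightarrow> f y = ereal b \<Longrightarrow> 0 < t \<Longrightarrow> t < 1 \<Longrightarrow>
      f ((1 - t) *\<^sub>R x + t *\<^sub>R y) \<le> ereal ((1 - t) * a + t * b)"
  shows "convex_fun f"
  unfolding convex_fun_def
proof (intro allI impI)
  fix x y and t :: real assume t: "0 < t" "t < 1"
  show "f ((1 - t) *\<^sub>R x + t *\<^sub>R y) \<le> ereal (1 - t) * f x + ereal t * f y"
    using cv[of x _ y _ t] t ninf[of x] ninf[of y] by (cases "f x"; cases "f y") auto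
qed

lemma convex_fun_add:
  assumes "convex_fun f" "convex_fun g" and ninf: "\<And>x. f x \<noteq> -\<infinity>" "\<And>x. g x \<noteq> -\<infinity>"
  shows "convex_fun (\<lambda>x. f x + g x)"
proof (rule convex_funI)
  show "f x + g x \<noteq> -\<infinity>" for x using ninf by (metis ereal_plus_eq_MInfty)
  fix x y a b and t :: real
  assume xy: "f x + g x = ereal a" "f y + g y = ereal b" and t: "0 < t" "t < 1"
  obtain f1 g1 where 1: "f x = ereal f1" "g x = ereal g1" "a = f1 + g1"
    using xy ninf[of x] by (cases "f x"; cases "g x") auto
  obtain f2 g2 where 2: "f y = ereal f2" "g y = ereal g2" "b = f2 + g2"
    using xy ninf[of y] by (cases "f y"; cases "g y") auto
  have "f ((1 - t) *\<^sub>R x + t *\<^sub>R y) + g ((1 - t) *\<^sub>R x + t *\<^sub>R y)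
      \<le> ereal ((1 - t) * f1 + t * f2) + ereal ((1 - t) * g1 + t * g2)"
    using 1 2 t assms by (intro add_mono convex_funD) auto
  then show "f ((1 - t) *\<^sub>R x + t *\<^sub>R y) + g ((1 - t) *\<^sub>R x + t *\<^sub>R y)
      \<le> ereal ((1 - t) * a + t * b)"
    by (simp add: 1 2 algebra_simps)
qed

lemma convex_fun_affine: "convex_fun (\<lambda>x. ereal (inner a x + b))"
  by (rule convex_funI) (auto simp: inner_right_distrib algebra_simps)

lemma proper_convex_lsc_scale:
  assumes f: "proper_convex_lsc f" and c: "0 < c"
  shows "proper_convex_lsc (\<lambda>x. ereal c * f x)"
proof -
  have ninf: "f x \<noteq> -\<infinity>" for x using f unfolding proper_convex_lsc_def proper_fun_def by blast
  have less: "ereal y < ereal c * f x \<longleftrightarrow> ereal (y / c) < f x" for x y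
    using c by (cases "f x") (auto simp: field_simps)
  have "proper_fun (\<lambda>x. ereal c * f x)"
    using f c unfolding proper_convex_lsc_def proper_fun_def by (auto simp: ereal_mult_eq_MInfty ereal_mult_eq_PInfty)
  moreover have "lsc_fun (\<lambda>x. ereal c * f x)"
    using f unfolding proper_convex_lsc_def lsc_fun_iff less by blast
  moreover have "convex_fun (\<lambda>x. ereal c * f x)"
  proof (rule convex_funI)
    show "ereal c * f x \<noteq> -\<infinity>" for x using ninf[of x] c by (cases "f x") auto
    fix x y a b and t :: real
    assume xy: "ereal c * f x = ereal a" "ereal c * f y = ereal b" and t: "0 < t" "t < 1"
    have "f x \<le> ereal (a / c)" "f y \<le> ereal (b / c)"
      using xy c by (cases "f x"; cases "f y"; auto)+
    then have "f ((1 - t) *\<^sub>R x + t *\<^sub>R y) \<le> ereal ((1 - t) * (a / c) + t * (b / c))"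
      using f t unfolding proper_convex_lsc_def by (intro convex_funD) auto
    then have "ereal c * f ((1 - t) *\<^sub>R x + t *\<^sub>R y) \<le> ereal c * ereal ((1 - t) * (a / c) + t * (b / c))"
      using c by (intro ereal_mult_left_mono) auto
    moreover have "c * ((1 - t) * (a / c) + t * (b / c)) = (1 - t) * a + t * b"
      using c by (simp add: distrib_left)
    ultimately show "ereal c * f ((1 - t) *\<^sub>R x + t *\<^sub>R y) \<le> ereal ((1 - t) * a + t * b)"
      by simp
  qed
  ultimately show ?thesis unfolding proper_convex_lsc_def by blast
qed

lemma proper_convex_lsc_conjugate:
  assumes proper: "proper_fun f" and dom: "fenchel_conjugate f y0 \<noteq> \<infinity>"
  shows "proper_convex_lsc (fenchel_conjugate f)"
proof -
  obtain x0 where x0: "\<bar>f x0\<bar> \<noteq> \<infinity>" using proper unfolding proper_fun_def by auto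
  have le: "ereal (inner y x) - f x \<le> fenchel_conjugate f y" for x y
    unfolding fenchel_conjugate_def by (intro SUP_upper) auto
  have ninf: "fenchel_conjugate f y \<noteq> -\<infinity>" for y
    using le[of y x0] x0 by (cases "f x0") auto
  have "lsc_fun (fenchel_conjugate f)"
    unfolding lsc_fun_iff
  proof (intro allI impI)
    fix x :: 'a and y assume "ereal y < fenchel_conjugate f x"
    then obtain w where w: "ereal y < ereal (inner x w) - f w"
      unfolding fenchel_conjugate_def less_SUP_iff by blast
    have "eventually (\<lambda>z. ereal y < ereal (inner z w) - f w) (nhds x)"
    proof (cases "f w")
      case (real r)
      have "((\<lambda>z. inner z w) \<longlongrightarrow> inner x w) (nhds x)" by (intro tendsto_intros filterlim_ident)
      moreover have "y + r < inner x w" using w real by simp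
      ultimately have "eventually (\<lambda>z. y + r < inner z w) (nhds x)" by (rule order_tendstoD)
      then show ?thesis by eventually_elim (simp add: real)
    qed (use w in auto)
    then show "eventually (\<lambda>z. ereal y < fenchel_conjugate f z) (nhds x)"
      by eventually_elim (use le in \<open>auto intro: less_le_trans\<close>)
  qed
  moreover have "convex_fun (fenchel_conjugate f)"
  proof (rule convex_funI[OF ninf])
    fix x y a b and t :: real
    assume xy: "fenchel_conjugate f x = ereal a" "fenchel_conjugate f y = ereal b"
      and t: "0 < t" "t < 1"
    show "fenchel_conjugate f ((1 - t) *\<^sub>R x + t *\<^sub>R y) \<le> ereal ((1 - t) * a + t * b)"
      unfolding fenchel_conjugate_def
    proof (rule SUP_least)
      fix z
      show "ereal (inner ((1 - t) *\<^sub>R x + t *\<^sub>R y) z) - f z \<le> ereal ((1 - t) * a + t * b)"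
      proof (cases "f z")
        case (real r)
        have "inner x z - r \<le> a" "inner y z - r \<le> b" using le[of x z] le[of y z] xy real by auto
        then have "(1 - t) * (inner x z - r) + t * (inner y z - r) \<le> (1 - t) * a + t * b"
          using t by (intro add_mono mult_left_mono) auto
        then show ?thesis by (simp add: real inner_left_distrib algebra_simps)
      next
        case MInf
        then show ?thesis using proper unfolding proper_fun_def by blast
      qed simp
    qed
  qed
  ultimately show ?thesis
    using ninf dom unfolding proper_convex_lsc_def proper_fun_def by blast
qed

lemma subdiff_monotone:
  assumes "g \<in> subdiff f x" "h \<in> subdiff f y"
  shows "0 \<le> inner (g - h) (x - y)"
proof -
  obtain a b where ab: "f x = ereal a" "f y = ereal b"
    using assms unfolding subdiff_def by (cases "f x"; cases "f y") auto
  have "f x + ereal (inner g (y - x)) \<le> f y" "f y + ereal (inner h (x - y)) \<le> f x"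
    using assms unfolding subdiff_def by auto
  then have "inner g (y - x) + inner h (x - y) \<le> 0" unfolding ab by simp
  then show ?thesis by (simp add: inner_diff_left inner_diff_right)
qed

lemma subdiff_scale:
  assumes "g \<in> subdiff (\<lambda>z. ereal c * f z) x" and c: "0 < c"
  shows "(1 / c) *\<^sub>R g \<in> subdiff f x"
proof -
  have "\<bar>ereal c * f x\<bar> \<noteq> \<infinity>" using assms(1) unfolding subdiff_def by auto
  then obtain a where a: "f x = ereal a" using c by (cases "f x") auto
  have "f x + ereal (inner ((1 / c) *\<^sub>R g) (y - x)) \<le> f y" for y
  proof -
    have "ereal c * f x + ereal (inner g (y - x)) \<le> ereal c * f y"
      using assms(1) unfolding subdiff_def by auto
    then show ?thesis using a c by (cases "f y") (auto simp: field_simps)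
  qed
  then show ?thesis using a unfolding subdiff_def by simp
qed

section \<open>Proximal maps\<close>

text \<open>
  Lower semicontinuity bounds \<open>f\<close> from below near a point of its domain, and convexity propagates
  the bound along rays.  Against this linear decay the quadratic term of the proximal problem wins.
\<close>

lemma proper_convex_lsc_lower_bound:
  assumes f: "proper_convex_lsc f"
  shows "\<exists>x0 a b. 0 \<le> b \<and> (\<forall>z. ereal (a - b * norm (z - x0)) \<le> f z)"
proof -
  have cv: "convex_fun f" and lsc: "lsc_fun f" using f unfolding proper_convex_lsc_def by auto
  obtain x0 r where r: "f x0 = ereal r"
    using f unfolding proper_convex_lsc_def proper_fun_def by (metis ereal_cases)
  then have "ereal (r - 1) < f x0" by simp
  then have "eventually (\<lambda>z. ereal (r - 1) < f z) (nhds x0)"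
    using lsc unfolding lsc_fun_iff by blast
  then obtain \<delta> where \<delta>: "0 < \<delta>" "\<And>z. dist z x0 < \<delta> \<Longrightarrow> ereal (r - 1) < f z"
    unfolding eventually_nhds_metric by blast
  have "ereal ((r - 1) - (2 / \<delta>) * norm (z - x0)) \<le> f z" for z
  proof (cases "norm (z - x0) < \<delta>")
    case True
    have "ereal ((r - 1) - (2 / \<delta>) * norm (z - x0)) \<le> ereal (r - 1)" using \<delta>(1) by simp
    also have "\<dots> \<le> f z" using \<delta>(2)[of z] True by (simp add: dist_norm less_imp_le)
    finally show ?thesis .
  next
    case False
    define n where "n = norm (z - x0)"
    have n: "\<delta> \<le> n" "0 < n" using False \<delta>(1) unfolding n_def by linarith+
    \<comment> \<open>The point of the segment at distance \<open>\<delta> / 2\<close> from \<open>x0\<close>.\<close>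
    define t where "t = \<delta> / (2 * n)"
    have t: "0 < t" "t < 1" unfolding t_def using n \<delta>(1) by (simp_all add: field_simps)
    show ?thesis
    proof (rule ccontr)
      assume "\<not> ?thesis"
      then have "f z \<le> ereal (r - (2 / \<delta>) * n)"
        unfolding not_le n_def[symmetric] by (rule order_trans[OF less_imp_le]) simp
      with r t have "f ((1 - t) *\<^sub>R x0 + t *\<^sub>R z) \<le> ereal ((1 - t) * r + t * (r - (2 / \<delta>) * n))"
        by (intro convex_funD[OF cv]) auto
      also have "(1 - t) * r + t * (r - (2 / \<delta>) * n) = r - t * ((2 / \<delta>) * n)"
        by (simp add: algebra_simps)
      also have "t * ((2 / \<delta>) * n) = 1" unfolding t_def using n \<delta>(1) by simp
      finally have up: "f ((1 - t) *\<^sub>R x0 + t *\<^sub>R z) \<le> ereal (r - 1)" .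
      have "(1 - t) *\<^sub>R x0 + t *\<^sub>R z - x0 = t *\<^sub>R (z - x0)" by (simp add: algebra_simps)
      then have "dist ((1 - t) *\<^sub>R x0 + t *\<^sub>R z) x0 = t * n"
        using t by (simp add: dist_norm n_def)
      also have "t * n < \<delta>" unfolding t_def using n \<delta>(1) by simp
      finally have "ereal (r - 1) < f ((1 - t) *\<^sub>R x0 + t *\<^sub>R z)" by (rule \<delta>(2))
      with up show False by simp
    qed
  qed
  then show ?thesis using \<delta>(1) by (intro exI[of _ x0] exI[of _ "r - 1"] exI[of _ "2 / \<delta>"]) simp
qed

lemma norm_add_scaleR_square:
  fixes x y :: "'a::real_inner"
  shows "(norm (x + t *\<^sub>R y))\<^sup>2 = (norm x)\<^sup>2 + 2 * t * inner x y + t\<^sup>2 * (norm y)\<^sup>2"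
  unfolding power2_norm_eq_inner
  by (simp add: inner_add_left inner_add_right inner_commute[of y x] power2_eq_square
      distrib_left)

lemma norm_midpoint_square:
  fixes x y :: "'a::real_inner"
  shows "(norm (midpoint x y - u))\<^sup>2
    = ((norm (x - u))\<^sup>2 + (norm (y - u))\<^sup>2) / 2 - (norm (x - y))\<^sup>2 / 4"
proof -
  define a b where "a = x - u" and "b = y - u"
  have "(x - u) + (y - u) = (x + y) - (u + u)" by simp
  then have "midpoint x y - u = (1/2) *\<^sub>R (a + b)" unfolding a_def b_def
    by (simp only: scaleR_diff_right scaleR_half_double midpoint_def inverse_eq_divide)
  then have "(norm (midpoint x y - u))\<^sup>2 = (1/2)\<^sup>2 * (norm (a + b))\<^sup>2"
    by (simp only: norm_scaleR power_mult_distrib power2_abs)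
  moreover have "(norm (a + b))\<^sup>2 = (norm a)\<^sup>2 + 2 * inner a b + (norm b)\<^sup>2"
    using norm_add_scaleR_square[of a 1 b] by simp
  moreover have "(norm (a - b))\<^sup>2 = (norm a)\<^sup>2 - 2 * inner a b + (norm b)\<^sup>2"
    using norm_add_scaleR_square[of a "-1" b] by simp
  moreover have xy: "x - y = a - b" unfolding a_def b_def by simp
  ultimately show ?thesis unfolding xy a_def[symmetric] b_def[symmetric]
    by (simp add: power_divide field_simps)
qed

lemma prox_minimises:
  fixes f :: "'a::{real_inner,complete_space} \<Rightarrow> ereal"
  assumes f: "proper_convex_lsc f"
  shows "f (prox f x) + ereal ((norm (prox f x - x))\<^sup>2 / 2) \<le> f z + ereal ((norm (z - x))\<^sup>2 / 2)"
proof -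
  define g where "g z = f z + ereal ((norm (z - x))\<^sup>2 / 2)" for z
  have cv: "convex_fun f" and lsc: "lsc_fun f" and ninf: "\<And>z. f z \<noteq> -\<infinity>"
    using f unfolding proper_convex_lsc_def proper_fun_def by auto
  obtain z0 where z0: "f z0 \<noteq> \<infinity>" using f unfolding proper_convex_lsc_def proper_fun_def by auto
  obtain x0 a b where b: "0 \<le> b" and lb: "\<And>z. ereal (a - b * norm (z - x0)) \<le> f z"
    using proper_convex_lsc_lower_bound[OF f] by blast
  have "\<exists>p. \<forall>y. g p \<le> g y"
  proof (rule strongly_midconvex_attains_min[where c = "1 / 8" and z = z0
        and lb = "a - b * norm (x - x0) - b\<^sup>2 / 2"])
    fix y z and \<alpha> \<beta> :: real
    assume le: "g y \<le> ereal \<alpha>" "g z \<le> ereal \<beta>"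
    have "f y \<le> ereal (\<alpha> - (norm (y - x))\<^sup>2 / 2)" "f z \<le> ereal (\<beta> - (norm (z - x))\<^sup>2 / 2)"
      using le unfolding g_def by (cases "f y"; cases "f z"; auto)+
    then have "f ((1 - 1 / 2) *\<^sub>R y + (1 / 2) *\<^sub>R z) \<le>
        ereal ((1 - 1 / 2) * (\<alpha> - (norm (y - x))\<^sup>2 / 2) + (1 / 2) * (\<beta> - (norm (z - x))\<^sup>2 / 2))"
      by (intro convex_funD[OF cv]) auto
    also have "(1 - 1 / 2) *\<^sub>R y + (1 / 2) *\<^sub>R z = midpoint y z"
      by (simp add: midpoint_def scaleR_add_right)
    finally have "g (midpoint y z) \<le>
        ereal ((1 - 1 / 2) * (\<alpha> - (norm (y - x))\<^sup>2 / 2) + (1 / 2) * (\<beta> - (norm (z - x))\<^sup>2 / 2))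
        + ereal ((norm (midpoint y z - x))\<^sup>2 / 2)"
      unfolding g_def by (rule add_right_mono)
    moreover have "(1 - 1 / 2) * (\<alpha> - (norm (y - x))\<^sup>2 / 2) + (1 / 2) * (\<beta> - (norm (z - x))\<^sup>2 / 2)
        + (norm (midpoint y z - x))\<^sup>2 / 2 = (\<alpha> + \<beta>) / 2 - 1 / 8 * (norm (y - z))\<^sup>2"
      by (simp add: norm_midpoint_square field_simps)
    ultimately show "g (midpoint y z) \<le> ereal ((\<alpha> + \<beta>) / 2 - 1 / 8 * (norm (y - z))\<^sup>2)"
      unfolding plus_ereal.simps by (simp only:)
  next
    fix z
    have "b * norm (z - x0) \<le> b * (norm (z - x) + norm (x - x0))"
      using norm_triangle_ineq[of "z - x" "x - x0"] b by (intro mult_left_mono) auto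
    moreover have "0 \<le> (norm (z - x) - b)\<^sup>2" by simp
    ultimately have "a - b * norm (x - x0) - b\<^sup>2 / 2 \<le> a - b * norm (z - x0) + (norm (z - x))\<^sup>2 / 2"
      by (simp add: power2_diff algebra_simps)
    then have "ereal (a - b * norm (x - x0) - b\<^sup>2 / 2)
        \<le> ereal (a - b * norm (z - x0)) + ereal ((norm (z - x))\<^sup>2 / 2)" by simp
    also have "\<dots> \<le> g z" unfolding g_def by (intro add_right_mono lb)
    finally show "ereal (a - b * norm (x - x0) - b\<^sup>2 / 2) \<le> g z" .
  next
    show "g z0 < \<infinity>" using z0 unfolding g_def by simp
  next
    fix \<alpha> :: real
    show "closed {z. g z \<le> ereal \<alpha>}"
      unfolding g_def
      by (intro closed_sublevel_if_lsc lsc_fun_add_continuous lsc ninf continuous_intros) auto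
  qed simp
  then obtain p where "is_arg_min g (\<lambda>_. True) p" unfolding is_arg_min_def by (auto simp: not_less)
  then have "is_arg_min g (\<lambda>_. True) (arg_min g (\<lambda>_. True))" unfolding arg_min_def by (rule someI)
  then have "g (prox f x) \<le> g z"
    unfolding prox_def g_def[abs_def] is_arg_min_def by (auto simp: not_less)
  then show ?thesis unfolding g_def .
qed

text \<open>Compare the minimiser with the points on the segment to \<open>y\<close>, to first order.\<close>

lemma prox_subgradient:
  fixes f :: "'a::{real_inner,complete_space} \<Rightarrow> ereal"
  assumes f: "proper_convex_lsc f"
  shows "x - prox f x \<in> subdiff f (prox f x)"
proof -
  define p where "p = prox f x"
  have min: "f p + ereal ((norm (p - x))\<^sup>2 / 2) \<le> f z + ereal ((norm (z - x))\<^sup>2 / 2)" for z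
    unfolding p_def by (rule prox_minimises[OF f])
  have cv: "convex_fun f" and ninf: "\<And>z. f z \<noteq> -\<infinity>"
    using f unfolding proper_convex_lsc_def proper_fun_def by auto
  obtain z0 where "f z0 \<noteq> \<infinity>" using f unfolding proper_convex_lsc_def proper_fun_def by auto
  then obtain a where a: "f p = ereal a"
    using min[of z0] ninf[of p] by (cases "f p") auto
  have "f p + ereal (inner (x - p) (y - p)) \<le> f y" for y
  proof (cases "f y")
    case (real b)
    have "a + inner (x - p) (y - p) - b \<le> 0"
    proof (rule nonpos_if_le_quadratic)
      fix t :: real assume t: "0 < t" "t < 1"
      define w where "w = inner (p - x) (y - p)"
      have "f p + ereal ((norm (p - x))\<^sup>2 / 2)
          \<le> f ((1 - t) *\<^sub>R p + t *\<^sub>R y) + ereal ((norm ((1 - t) *\<^sub>R p + t *\<^sub>R y - x))\<^sup>2 / 2)"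
        by (rule min)
      also have "\<dots> \<le> ereal ((1 - t) * a + t * b) + ereal ((norm ((1 - t) *\<^sub>R p + t *\<^sub>R y - x))\<^sup>2 / 2)"
        using a real t by (intro add_right_mono convex_funD[OF cv]) auto
      also have "(1 - t) *\<^sub>R p + t *\<^sub>R y - x = (p - x) + t *\<^sub>R (y - p)" by (simp add: algebra_simps)
      finally have "a + (norm (p - x))\<^sup>2 / 2 \<le> (1 - t) * a + t * b + ((norm (p - x))\<^sup>2
          + 2 * t * w + t\<^sup>2 * (norm (y - p))\<^sup>2) / 2"
        unfolding a w_def norm_add_scaleR_square by simp
      moreover have "inner (x - p) (y - p) = - w"
        unfolding w_def by (metis inner_minus_left minus_diff_eq)
      ultimately show "t * (a + inner (x - p) (y - p) - b) \<le> t\<^sup>2 * ((norm (y - p))\<^sup>2 / 2)"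
        by (simp add: field_simps)
    qed
    then show ?thesis unfolding a real by simp
  qed (use ninf in auto)
  then show ?thesis using a unfolding subdiff_def p_def by simp
qed

section \<open>Gradients and directional derivatives\<close>

lemma GDERIV_unique:
  assumes "GDERIV f x :> D" "GDERIV f x :> D'" shows "D = D'"
proof -
  have "(\<lambda>h. inner h D) = (\<lambda>h. inner h D')"
    using assms unfolding gderiv_def by (rule has_derivative_unique)
  then have "inner (D - D') (D - D') = 0" by (metis inner_diff_right right_minus_eq)
  then show ?thesis by simp
qed

lemma gradient_eqI: "GDERIV (\<lambda>z. real_of_ereal (f z)) x :> D \<Longrightarrow> gradient f x = D"
  unfolding gradient_def using GDERIV_unique by blast

lemma GDERIV_gradient:
  assumes "differentiable_fun f"
  shows "GDERIV (\<lambda>z. real_of_ereal (f z)) x :> gradient f x"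
  using assms gradient_eqI unfolding differentiable_fun_def by metis

lemma gradient_inequality:
  assumes cv: "convex_fun f" and diff: "differentiable_fun f"
  shows "real_of_ereal (f x) + inner (gradient f x) (z - x) \<le> real_of_ereal (f z)"
proof -
  define e where "e x = real_of_ereal (f x)" for x
  have e: "f x = ereal (e x)" for x
    using diff unfolding differentiable_fun_def e_def by (simp add: ereal_real')
  define g where "g t = e (x + t *\<^sub>R (z - x))" for t
  have "convex_on UNIV g"
  proof (rule convex_onI)
    fix t r s :: real assume t: "0 < t" "t < 1"
    have "f ((1 - t) *\<^sub>R (x + r *\<^sub>R (z - x)) + t *\<^sub>R (x + s *\<^sub>R (z - x)))
        \<le> ereal ((1 - t) * g r + t * g s)"
      using t by (intro convex_funD[OF cv]) (auto simp: g_def e)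
    also have "(1 - t) *\<^sub>R (x + r *\<^sub>R (z - x)) + t *\<^sub>R (x + s *\<^sub>R (z - x))
        = x + ((1 - t) *\<^sub>R r + t *\<^sub>R s) *\<^sub>R (z - x)" by (simp add: algebra_simps)
    finally show "g ((1 - t) *\<^sub>R r + t *\<^sub>R s) \<le> (1 - t) * g r + t * g s"
      by (simp add: e g_def)
  qed simp
  moreover have "(g has_real_derivative inner (gradient f x) (z - x)) (at 0 within UNIV)"
  proof -
    have "(e has_derivative (\<lambda>h. inner h (gradient f x))) (at (x + 0 *\<^sub>R (z - x)))"
      using GDERIV_gradient[OF diff, of x] unfolding gderiv_def e_def[abs_def] by simp
    moreover have "((\<lambda>t. x + t *\<^sub>R (z - x)) has_derivative (\<lambda>t. t *\<^sub>R (z - x))) (at 0)"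
      by (auto intro!: derivative_eq_intros)
    ultimately have "((\<lambda>t. e (x + t *\<^sub>R (z - x))) has_derivative
        (\<lambda>t. inner (t *\<^sub>R (z - x)) (gradient f x))) (at 0)"
      by (rule has_derivative_compose[rotated])
    then show ?thesis
      unfolding has_field_derivative_def g_def by (simp add: inner_commute mult_commute_abs)
  qed
  ultimately have "inner (gradient f x) (z - x) * (1 - 0) \<le> g 1 - g 0"
    by (intro convex_on_imp_above_tangent) auto
  then show ?thesis unfolding g_def e_def by simp
qed

text \<open>
  The inner product is what remains of the gradients when two forward-backward steps, from \<open>x\<close> and
  from \<open>x'\<close>, are compared and these steps differ by \<open>\<delta>\<close>.  At \<open>x + \<delta> / 2\<close> the function lies
  above its tangent at \<open>x'\<close> and at most \<open>L * (norm (\<delta> / 2))\<^sup>2\<close> above its tangent at \<open>x\<close>; at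
  \<open>x' - \<delta> / 2\<close> the roles are exchanged.  The sum of the two comparisons is the claim.
\<close>

lemma gradient_step_inequality:
  assumes cv: "convex_fun f" and diff: "differentiable_fun f"
    and lip: "L-lipschitz_on UNIV (gradient f)"
  shows "- (L / 2) * (norm \<delta>)\<^sup>2 \<le> inner (gradient f x - gradient f x') (x - x' + \<delta>)"
proof -
  define e where "e x = real_of_ereal (f x)" for x
  have tangent: "e x + inner (gradient f x) (z - x) \<le> e z" for x z
    unfolding e_def by (rule gradient_inequality[OF cv diff])
  have growth: "e (x + h) \<le> e x + inner (gradient f x) h + L * (norm h)\<^sup>2" for x h
  proof -
    have "inner (gradient f (x + h) - gradient f x) h \<le> norm (gradient f (x + h) - gradient f x) * norm h"
      by (rule norm_cauchy_schwarz)
    also have "\<dots> \<le> (L * norm h) * norm h"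
      using lipschitz_onD[OF lip, of "x + h" x] by (intro mult_right_mono) (auto simp: dist_norm)
    finally show ?thesis
      using tangent[of "x + h" x] by (simp add: inner_diff_left power2_eq_square)
  qed
  define h where "h = (1/2) *\<^sub>R \<delta>"
  have "e x' + inner (gradient f x') (x + h - x') \<le> e x + inner (gradient f x) h + L * (norm h)\<^sup>2"
    using tangent[of x' "x + h"] growth[of x h] by simp
  moreover have "e x + inner (gradient f x) (x' - h - x)
      \<le> e x' - inner (gradient f x') h + L * (norm h)\<^sup>2"
    using tangent[of x "x' - h"] growth[of x' "- h"] by simp
  ultimately have "- (2 * (L * (norm h)\<^sup>2)) \<le> inner (gradient f x - gradient f x') (x - x' + (h + h))"
    by (simp add: inner_diff_left inner_diff_right inner_add_right)
  moreover have "2 * (L * (norm h)\<^sup>2) = (L / 2) * (norm \<delta>)\<^sup>2"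
    unfolding h_def by (simp add: power_divide)
  moreover have "h + h = \<delta>" unfolding h_def by (simp flip: scaleR_2)
  ultimately show ?thesis by simp
qed

text \<open>
  Along the segment the difference quotients are real and nondecreasing, and the subgradient bounds
  them from below; hence their limit, the directional derivative, is real and bounded by each of them.
\<close>

lemma dir_deriv_le_difference:
  assumes cv: "convex_fun f" and p: "p \<in> subdiff f x" and \<theta>: "0 < \<theta>"
    and fin: "f (x + \<theta> *\<^sub>R d) < \<infinity>"
  obtains r where "dir_deriv f x d = ereal r"
    "\<theta> * r \<le> real_of_ereal (f (x + \<theta> *\<^sub>R d)) - real_of_ereal (f x)"
proof -
  obtain a where a: "f x = ereal a" using p unfolding subdiff_def by (cases "f x") auto
  have sub: "f x + ereal (inner p (y - x)) \<le> f y" for y using p unfolding subdiff_def by auto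
  have ninf: "f y \<noteq> -\<infinity>" for y using sub[of y] a by (cases "f y") auto
  define \<phi> where "\<phi> t = real_of_ereal (f (x + t *\<^sub>R d))" for t
  have step: "f (x + s *\<^sub>R d) \<le> ereal ((1 - s / t) * a + s / t * b)"
    if "0 < s" "s < t" "f (x + t *\<^sub>R d) \<le> ereal b" for s t b
  proof -
    have "f ((1 - s / t) *\<^sub>R x + (s / t) *\<^sub>R (x + t *\<^sub>R d)) \<le> ereal ((1 - s / t) * a + s / t * b)"
      using that a by (intro convex_funD[OF cv]) auto
    moreover have "(1 - s / t) *\<^sub>R x + (s / t) *\<^sub>R (x + t *\<^sub>R d) = x + s *\<^sub>R d"
      using that by (simp add: algebra_simps)
    ultimately show ?thesis by simp
  qed
  obtain b where b: "f (x + \<theta> *\<^sub>R d) = ereal b"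
    using fin ninf[of "x + \<theta> *\<^sub>R d"] by (cases "f (x + \<theta> *\<^sub>R d)") auto
  have \<phi>: "f (x + t *\<^sub>R d) = ereal (\<phi> t)" if "0 < t" "t \<le> \<theta>" for t
  proof (cases "t = \<theta>")
    case True
    then show ?thesis by (simp add: \<phi>_def b)
  next
    case False
    then have "f (x + t *\<^sub>R d) \<noteq> \<infinity>" using step[of t \<theta> b] that b by auto
    then show ?thesis using ninf[of "x + t *\<^sub>R d"] by (cases "f (x + t *\<^sub>R d)") (auto simp: \<phi>_def)
  qed
  define q where "q t = (\<phi> t - a) / t" for t
  define J where "J = {0<..\<theta>}"
  have mono: "q s \<le> q t" if "s \<in> J" "t \<in> J" "0 < s" "s \<le> t" for s t
  proof (cases "s = t")
    case False
    then have "f (x + s *\<^sub>R d) \<le> ereal ((1 - s / t) * a + s / t * \<phi> t)"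
      using that \<phi>[of t] unfolding J_def by (intro step) auto
    then have "\<phi> s - a \<le> s / t * (\<phi> t - a)"
      using that \<phi>[of s] unfolding J_def by (simp add: algebra_simps)
    then have "(\<phi> s - a) / s \<le> (s / t * (\<phi> t - a)) / s" using that by (intro divide_right_mono) auto
    then show ?thesis using that unfolding q_def by simp
  qed simp
  have bnd: "inner p d \<le> q t" if "t \<in> J" "0 < t" for t
    using sub[of "x + t *\<^sub>R d"] \<phi>[of t] that a unfolding J_def q_def by (simp add: field_simps)
  have "(q \<longlongrightarrow> Inf (q ` ({0<..} \<inter> J))) (at 0 within ({0<..} \<inter> J))"
    using mono bnd by (rule Lim_right_bound)
  moreover have "at 0 within ({0<..} \<inter> J) = at_right 0"
    by (rule at_within_nhd[where S = "{..<\<theta>}"]) (auto simp: J_def \<theta>)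
  ultimately obtain r where r: "(q \<longlongrightarrow> r) (at_right 0)" by auto
  have J: "eventually (\<lambda>t. t \<in> J) (at_right 0)"
    using eventually_at_right_less[of 0] eventually_at_right_field[of _ 0]
    unfolding J_def using \<theta> by (auto simp: eventually_at_right_field intro!: exI[of _ \<theta>])
  have quot: "eventually (\<lambda>t. ereal (q t) = (f (x + t *\<^sub>R d) - f x) / ereal t) (at_right 0)"
    using J by eventually_elim (auto simp: J_def q_def \<phi> a)
  have "((\<lambda>t. ereal (q t)) \<longlongrightarrow> ereal r) (at_right 0)" using r by simp
  then have "((\<lambda>t. (f (x + t *\<^sub>R d) - f x) / ereal t) \<longlongrightarrow> ereal r) (at_right 0)"
    using quot by (rule Lim_transform_eventually)
  then have "dir_deriv f x d = ereal r"
    unfolding dir_deriv_def by (intro tendsto_Lim) auto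
  moreover have "r \<le> q \<theta>"
    by (rule tendsto_upperbound[OF r]) (use J mono \<theta> in \<open>auto simp: J_def elim!: eventually_mono\<close>)
  then have "\<theta> * r \<le> \<phi> \<theta> - a" using \<theta> unfolding q_def by (simp add: field_simps)
  ultimately show ?thesis using that[of r] a unfolding \<phi>_def by simp
qed

section \<open>Quasi-monotone real sequences\<close>

text \<open>A discrete Gronwall inequality; \<open>1 + e k\<close> is estimated by \<open>exp (e k)\<close>.\<close>

lemma gronwall_bounded:
  fixes a e r :: "nat \<Rightarrow> real"
  assumes nonneg: "\<And>k. 0 \<le> a k" "\<And>k. 0 \<le> e k" "\<And>k. 0 \<le> r k"
    and sums: "summable e" "summable r"
    and step: "\<And>k. a (Suc k) \<le> (1 + e k) * a k + r k"
  shows "\<exists>A. \<forall>k. a k \<le> A"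
proof -
  have bound: "a k \<le> (a 0 + (\<Sum>i<k. r i)) * exp (\<Sum>i<k. e i)" for k
  proof (induction k)
    case 0
    show ?case by simp
  next
    case (Suc k)
    define S X where "S = a 0 + (\<Sum>i<k. r i)" and "X = (\<Sum>i<k. e i)"
    have S: "0 \<le> S" and X: "0 \<le> X" unfolding S_def X_def using nonneg by (auto intro!: add_nonneg_nonneg sum_nonneg)
    have "a (Suc k) \<le> (1 + e k) * a k + r k" by (rule step)
    also have "\<dots> \<le> exp (e k) * (S * exp X) + r k * exp (X + e k)"
    proof (intro add_mono mult_mono)
      show "1 + e k \<le> exp (e k)" by (rule exp_ge_add_one_self)
      show "a k \<le> S * exp X" using Suc unfolding S_def X_def .
      have "r k * 1 \<le> r k * exp (X + e k)" using nonneg X by (intro mult_left_mono) auto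
      then show "r k \<le> r k * exp (X + e k)" by simp
    qed (use nonneg in auto)
    also have "\<dots> = (S + r k) * exp (X + e k)" by (simp add: exp_add algebra_simps)
    finally show ?case unfolding S_def X_def by (simp add: add.assoc)
  qed
  have "a k \<le> (a 0 + suminf r) * exp (suminf e)" for k
  proof -
    have "(a 0 + (\<Sum>i<k. r i)) * exp (\<Sum>i<k. e i) \<le> (a 0 + suminf r) * exp (suminf e)"
      using nonneg sums by (intro mult_mono add_left_mono) (auto intro!: sum_le_suminf add_nonneg_nonneg suminf_nonneg)
    with bound[of k] show ?thesis by simp
  qed
  then show ?thesis by blast
qed

lemma quasi_decreasing_convergent:
  fixes a b \<gamma> :: "nat \<Rightarrow> real"
  assumes nonneg: "\<And>k. 0 \<le> a k" "\<And>k. 0 \<le> b k" "\<And>k. 0 \<le> \<gamma> k"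
    and sums: "summable \<gamma>"
    and step: "\<And>k. a (Suc k) \<le> a k + \<gamma> k - b k"
  shows "convergent a" and "b \<longlonglongrightarrow> 0"
proof -
  define t where "t k = a k - (\<Sum>i<k. \<gamma> i)" for k
  have "decseq t"
  proof (rule decseq_SucI)
    fix k show "t (Suc k) \<le> t k" using step[of k] nonneg(2)[of k] unfolding t_def by simp
  qed
  moreover have "- suminf \<gamma> \<le> t k" for k
    using sum_le_suminf[OF sums, of "{..<k}"] nonneg(1)[of k] nonneg(3) unfolding t_def by simp
  ultimately obtain l where l: "t \<longlonglongrightarrow> l" using decseq_convergent by blast
  have "(\<lambda>k. t k + (\<Sum>i<k. \<gamma> i)) \<longlonglongrightarrow> l + suminf \<gamma>"
    by (intro tendsto_add l summable_LIMSEQ sums)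
  then have a: "a \<longlonglongrightarrow> l + suminf \<gamma>" unfolding t_def by simp
  then show "convergent a" unfolding convergent_def by blast
  have "(\<lambda>k. a k + \<gamma> k - a (Suc k)) \<longlonglongrightarrow> (l + suminf \<gamma>) + 0 - (l + suminf \<gamma>)"
    by (intro tendsto_intros a summable_LIMSEQ_zero sums LIMSEQ_Suc)
  then have "(\<lambda>k. a k + \<gamma> k - a (Suc k)) \<longlonglongrightarrow> 0" by simp
  then show "b \<longlonglongrightarrow> 0"
    by (rule real_tendsto_sandwich[OF _ _ tendsto_const, rotated 2])
      (use step nonneg in \<open>auto simp: algebra_simps intro!: always_eventually\<close>)
qed

lemma summable_if_summable_on:
  fixes f :: "nat \<Rightarrow> real"
  assumes "f summable_on I" "\<And>k. k \<in> I \<Longrightarrow> 0 \<le> f k"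
  shows "summable (\<lambda>k. if k \<in> I then f k else 0)"
proof -
  have "(\<lambda>k. if k \<in> I then f k else 0) summable_on UNIV"
    using assms(1) by (subst summable_on_cong_neutral[of I UNIV f]) auto
  then show ?thesis by (rule summable_on_imp_summable)
qed

section \<open>The primal-dual proximal splitting step\<close>

text \<open>
  \<open>forward_backward F E G K \<tau> \<sigma> u w\<close> holds if \<open>w\<close> solves the inclusion that defines the primal-dual
  proximal step from \<open>u\<close>; the solutions of the primal-dual problem are its fixed points.
\<close>

definition forward_backward ::
  "('x::real_inner \<Rightarrow> ereal) \<Rightarrow> ('x \<Rightarrow> ereal) \<Rightarrow> ('y::real_inner \<Rightarrow> ereal) \<Rightarrow> ('x \<Rightarrow>\<^sub>L 'y) \<Rightarrow> real \<Rightarrow> real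
   \<Rightarrow> 'x \<times> 'y \<Rightarrow> 'x \<times> 'y \<Rightarrow> bool" where
  "forward_backward F E G K \<tau> \<sigma> u w \<longleftrightarrow>
     - (gradient (Ebar E) u + op_Xi K w + op_M \<tau> \<sigma> K (w - u)) \<in> subdiff (Gbar F G) w"

lemma subdiff_Gbar:
  assumes "g \<in> subdiff F x" "h \<in> subdiff (fenchel_conjugate G) y"
  shows "(g, h) \<in> subdiff (Gbar F G) (x, y)"
proof -
  obtain a b where ab: "F x = ereal a" "fenchel_conjugate G y = ereal b"
    using assms unfolding subdiff_def by (cases "F x"; cases "fenchel_conjugate G y") auto
  have "Gbar F G (x, y) + ereal (inner (g, h) (z - (x, y))) \<le> Gbar F G z" for z
  proof -
    have "F x + ereal (inner g (fst z - x)) + (fenchel_conjugate G y + ereal (inner h (snd z - y)))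
        \<le> F (fst z) + fenchel_conjugate G (snd z)"
      using assms unfolding subdiff_def by (intro add_mono) auto
    then show ?thesis by (cases z) (simp add: Gbar_def ab algebra_simps)
  qed
  moreover have "\<bar>Gbar F G (x, y)\<bar> \<noteq> \<infinity>" by (simp add: Gbar_def ab)
  ultimately show ?thesis unfolding subdiff_def by blast
qed

lemma convex_fun_compose_linear:
  assumes "convex_fun f" "linear A"
  shows "convex_fun (\<lambda>x. f (A x))"
  using assms unfolding convex_fun_def by (simp add: linear_add linear_scale)

lemma gradient_Ebar:
  assumes "differentiable_fun E"
  shows "gradient (Ebar E) u = (gradient E (fst u), 0)"
proof (rule gradient_eqI)
  have "((\<lambda>z. real_of_ereal (E z)) has_derivative (\<lambda>h. inner h (gradient E (fst u)))) (at (fst u))"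
    using GDERIV_gradient[OF assms] unfolding gderiv_def .
  then have "((\<lambda>z. real_of_ereal (E (fst z))) has_derivative (\<lambda>h. inner (fst h) (gradient E (fst u)))) (at u)"
    by (rule has_derivative_compose[OF has_derivative_fst[OF has_derivative_ident]])
  then show "GDERIV (\<lambda>z. real_of_ereal (Ebar E z)) u :> (gradient E (fst u), 0)"
    unfolding gderiv_def Ebar_def by (simp add: case_prod_beta inner_prod_def)
qed

locale primal_dual =
  fixes F E :: "'x::{real_inner,complete_space} \<Rightarrow> ereal"
    and G :: "'y::{real_inner,complete_space} \<Rightarrow> ereal"
    and K :: "'x \<Rightarrow>\<^sub>L 'y" and L \<tau> \<sigma> :: real
  assumes struct: "pd_structure F E G L K \<tau> \<sigma>"
    and solvable: "pd_solutions F E G K \<noteq> {}"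
begin

abbreviation "M \<equiv> op_M \<tau> \<sigma> K"
abbreviation "Xi \<equiv> op_Xi K"
abbreviation "gE \<equiv> gradient (Ebar E)"
abbreviation "FB \<equiv> forward_backward F E G K \<tau> \<sigma>"
abbreviation "solutions \<equiv> pd_solutions F E G K"
abbreviation "step \<equiv> pdps_step F E G K \<tau> \<sigma>"

lemma tau_pos: "0 < \<tau>" and sigma_pos: "0 < \<sigma>" and L_nonneg: "0 \<le> L"
  and step_lengths: "\<tau> * L + \<tau> * \<sigma> * (norm K)\<^sup>2 < 1"
  and F: "proper_convex_lsc F" and E: "convex_fun E" and G: "proper_fun G"
  and E_diff: "differentiable_fun E" and E_lip: "L-lipschitz_on UNIV (gradient E)"
  using struct unfolding pd_structure_def proper_convex_lsc_def by (auto dest: lipschitz_on_nonneg)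

lemma K_adjoint: "inner (blinfun_apply K x) y = inner x (adjoint (blinfun_apply K) y)"
  by (rule adjoint_exists[OF blinfun.bounded_linear_right])

lemma bounded_linear_K_adjoint: "bounded_linear (adjoint (blinfun_apply K))"
  by (rule bounded_linear_adjoint[OF blinfun.bounded_linear_right])

lemma bounded_linear_M: "bounded_linear M"
proof -
  have "bounded_linear (\<lambda>u. ((1 / \<tau>) *\<^sub>R fst u - adjoint (blinfun_apply K) (snd u),
      - blinfun_apply K (fst u) + (1 / \<sigma>) *\<^sub>R snd u))"
    by (intro bounded_linear_Pair bounded_linear_sub bounded_linear_add bounded_linear_minus
        bounded_linear_compose[OF bounded_linear_scaleR_right] bounded_linear_fst bounded_linear_snd
        bounded_linear_compose[OF bounded_linear_K_adjoint]
        bounded_linear_compose[OF blinfun.bounded_linear_right])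
  then show ?thesis unfolding op_M_def case_prod_beta .
qed

lemma bounded_linear_Xi: "bounded_linear Xi"
proof -
  have "bounded_linear (\<lambda>u. (adjoint (blinfun_apply K) (snd u), - blinfun_apply K (fst u)))"
    by (intro bounded_linear_Pair bounded_linear_minus bounded_linear_fst bounded_linear_snd
        bounded_linear_compose[OF bounded_linear_K_adjoint]
        bounded_linear_compose[OF blinfun.bounded_linear_right])
  then show ?thesis unfolding op_Xi_def case_prod_beta .
qed

lemma inner_Xi_self: "inner (Xi u) u = 0"
  using K_adjoint[of "fst u" "snd u"]
  unfolding op_Xi_def case_prod_beta inner_prod_def by (simp add: inner_commute)

lemma inner_M:
  "inner (M (x, y)) (x', y') =
     inner x x' / \<tau> - inner (blinfun_apply K x') y - inner (blinfun_apply K x) y' + inner y y' / \<sigma>"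
  by (simp add: op_M_def inner_diff_left inner_add_left K_adjoint[of x'] inner_commute[of x'])

text \<open>
  The modulus makes \<open>(1 / \<tau> - L - modulus) * (1 / \<sigma> - modulus)\<close> at least the square of the norm
  of \<open>K\<close>, so that even \<open>M - \<Lambda>\<close>, and not only \<open>M\<close>, is coercive with this constant.
\<close>

definition modulus :: real where
  "modulus = ((1 / \<tau> - L) / \<sigma> - (norm K)\<^sup>2) / (1 / \<tau> - L + 1 / \<sigma>)"

lemma modulus_pos: "0 < modulus" and M_minus_Lambda_coercive:
  "modulus * (norm u)\<^sup>2 \<le> inner (M u) u - L * (norm (fst u))\<^sup>2"
proof -
  define a b k where "a = 1 / \<tau> - L" and "b = 1 / \<sigma>" and "k = norm K"
  have "\<tau> * L < 1" using step_lengths tau_pos sigma_pos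
    by (smt (verit) mult_nonneg_nonneg zero_le_power2)
  then have a: "0 < a" unfolding a_def using tau_pos by (simp add: field_simps)
  have b: "0 < b" unfolding b_def using sigma_pos by simp
  have "\<sigma> * k\<^sup>2 < a"
    using step_lengths tau_pos unfolding a_def k_def by (simp add: field_simps)
  then have ab: "k\<^sup>2 < a * b" unfolding b_def using sigma_pos by (simp add: field_simps)
  have m: "modulus = (a * b - k\<^sup>2) / (a + b)" unfolding modulus_def a_def b_def k_def by simp
  show "0 < modulus" unfolding m using a b ab by simp
  have prod: "(a - modulus) * (b - modulus) = k\<^sup>2 + modulus\<^sup>2"
  proof -
    have "modulus * (a + b) = a * b - k\<^sup>2" using a b unfolding m by simp
    then show ?thesis by (simp add: algebra_simps power2_eq_square)
  qed
  have am: "0 < a - modulus"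
  proof -
    have "a - modulus = (a\<^sup>2 + k\<^sup>2) / (a + b)" using a b unfolding m by (simp add: field_simps power2_eq_square)
    also have "\<dots> > 0" using a b by (intro divide_pos_pos add_pos_nonneg) auto
    finally show ?thesis .
  qed
  obtain x y where u: "u = (x, y)" by (cases u)
  define X Y where "X = norm x" and "Y = norm y"
  have "0 \<le> ((a - modulus) * X - k * Y)\<^sup>2 + modulus\<^sup>2 * Y\<^sup>2" by simp
  also have "\<dots> = (a - modulus)\<^sup>2 * X\<^sup>2 - 2 * (a - modulus) * k * X * Y + (k\<^sup>2 + modulus\<^sup>2) * Y\<^sup>2"
    by (simp add: power2_eq_square algebra_simps)
  also have "\<dots> = (a - modulus) * ((a - modulus) * X\<^sup>2 - 2 * k * X * Y + (b - modulus) * Y\<^sup>2)"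
    unfolding prod[symmetric] by (simp add: power2_eq_square algebra_simps)
  finally have nonneg: "0 \<le> (a - modulus) * X\<^sup>2 - 2 * k * X * Y + (b - modulus) * Y\<^sup>2"
    using am by (simp add: zero_le_mult_iff)
  have "inner (blinfun_apply K x) y \<le> norm (blinfun_apply K x) * norm y" by (rule norm_cauchy_schwarz)
  also have "\<dots> \<le> (k * X) * Y" unfolding k_def X_def Y_def by (intro mult_right_mono norm_blinfun) simp
  finally have "inner (blinfun_apply K x) y \<le> k * X * Y" .
  moreover have "(norm u)\<^sup>2 = X\<^sup>2 + Y\<^sup>2"
    unfolding u X_def Y_def by (simp add: power2_norm_eq_inner)
  moreover have "inner (M u) u = (a + L) * X\<^sup>2 - 2 * inner (blinfun_apply K x) y + b * Y\<^sup>2"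
    unfolding u inner_M a_def b_def X_def Y_def by (simp add: power2_norm_eq_inner)
  ultimately show "modulus * (norm u)\<^sup>2 \<le> inner (M u) u - L * (norm (fst u))\<^sup>2"
    using nonneg unfolding u by (simp add: algebra_simps X_def[symmetric])
qed

sublocale metric: equivalent_inner_product "\<lambda>u v. inner (M u) v" modulus
proof (intro equivalent_inner_product.intro equivalent_inner_product_axioms.intro)
  show "bounded_bilinear (\<lambda>u v. inner (M u) v)"
    using bounded_bilinear.comp[OF bounded_bilinear_inner bounded_linear_M bounded_linear_ident] .
  show "inner (M x) y = inner (M y) x" for x y
    by (cases x; cases y) (simp only: inner_M, simp add: inner_commute)
  show "modulus * (norm x)\<^sup>2 \<le> inner (M x) x" for x
    using M_minus_Lambda_coercive[of x] L_nonneg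
      mult_nonneg_nonneg[OF L_nonneg zero_le_power2[of "norm (fst x)"]] by linarith
qed (rule modulus_pos)

lemma solutions_iff: "u \<in> solutions \<longleftrightarrow> FB u u"
proof -
  have "0 = g + gE u + Xi u \<longleftrightarrow> g = - (gE u + Xi u)" for g
    unfolding eq_neg_iff_add_eq_0 add.assoc by (rule eq_commute)
  then have "u \<in> solutions \<longleftrightarrow> - (gE u + Xi u) \<in> subdiff (Gbar F G) u"
    unfolding pd_solutions_def image_iff mem_Collect_eq by simp
  moreover have "M (u - u) = 0" using linear_0[OF bounded_linear.linear[OF bounded_linear_M]] by simp
  ultimately show ?thesis unfolding forward_backward_def by simp
qed

lemma conjugate: "proper_convex_lsc (fenchel_conjugate G)"
proof -
  obtain x y where "(x, y) \<in> solutions" using solvable by auto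
  then have "\<bar>Gbar F G (x, y)\<bar> \<noteq> \<infinity>" unfolding pd_solutions_def subdiff_def by auto
  then have "fenchel_conjugate G y \<noteq> \<infinity>" unfolding Gbar_def by auto
  with G show ?thesis by (rule proper_convex_lsc_conjugate)
qed

lemma Gbar_not_MInf: "Gbar F G u \<noteq> -\<infinity>"
  using F conjugate unfolding Gbar_def proper_convex_lsc_def proper_fun_def by (cases u) auto

lemma convex_Gbar: "convex_fun (Gbar F G)"
proof -
  have cv: "convex_fun F" "convex_fun (fenchel_conjugate G)"
    and ninf: "\<And>x. F x \<noteq> -\<infinity>" "\<And>y. fenchel_conjugate G y \<noteq> -\<infinity>"
    using F conjugate unfolding proper_convex_lsc_def proper_fun_def by auto
  have "convex_fun (\<lambda>u. F (fst u) + fenchel_conjugate G (snd u))"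
    using convex_fun_compose_linear[OF cv(1) linear_fst] convex_fun_compose_linear[OF cv(2) linear_snd] ninf
    by (rule convex_fun_add)
  then show ?thesis unfolding Gbar_def case_prod_beta .
qed

text \<open>
  The inclusion consists of the optimality conditions of the two proximal problems, scaled by
  \<open>1 / \<tau>\<close> and \<open>1 / \<sigma>\<close>; the terms \<open>\<Xi>\<close> and \<open>M\<close> are chosen so that the old dual iterate
  appears in the first condition and the extrapolated primal one in the second.
\<close>

lemma step_forward_backward: "FB u (step u)"
proof -
  obtain x y where u: "u = (x, y)" by (cases u)
  define Ka where "Ka = adjoint (blinfun_apply K)"
  interpret Ka: bounded_linear Ka unfolding Ka_def by (rule bounded_linear_K_adjoint)
  define a where "a = x - \<tau> *\<^sub>R (gradient E x + Ka y)"
  define xp where "xp = prox (\<lambda>z. ereal \<tau> * F z) a"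
  define b where "b = y + \<sigma> *\<^sub>R blinfun_apply K (2 *\<^sub>R xp - x)"
  define yp where "yp = prox (\<lambda>z. ereal \<sigma> * fenchel_conjugate G z) b"
  have s: "step u = (xp, yp)"
    unfolding u pdps_step_def Let_def xp_def yp_def a_def b_def Ka_def by simp
  have "(1 / \<tau>) *\<^sub>R (a - xp) \<in> subdiff F xp"
    unfolding xp_def by (intro subdiff_scale prox_subgradient proper_convex_lsc_scale F tau_pos)
  moreover have "(1 / \<sigma>) *\<^sub>R (b - yp) \<in> subdiff (fenchel_conjugate G) yp"
    unfolding yp_def by (intro subdiff_scale prox_subgradient proper_convex_lsc_scale conjugate sigma_pos)
  ultimately have "((1 / \<tau>) *\<^sub>R (a - xp), (1 / \<sigma>) *\<^sub>R (b - yp)) \<in> subdiff (Gbar F G) (xp, yp)"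
    by (rule subdiff_Gbar)
  moreover have "((1 / \<tau>) *\<^sub>R (a - xp), (1 / \<sigma>) *\<^sub>R (b - yp))
      = - (gE u + Xi (xp, yp) + M ((xp, yp) - u))"
  proof (rule prod_eqI)
    have "(1 / \<tau>) *\<^sub>R (a - xp) = (1 / \<tau>) *\<^sub>R (x - xp) - (gradient E x + Ka y)"
      using tau_pos unfolding a_def by (simp add: scaleR_diff_right)
    then show "fst ((1 / \<tau>) *\<^sub>R (a - xp), (1 / \<sigma>) *\<^sub>R (b - yp))
        = fst (- (gE u + Xi (xp, yp) + M ((xp, yp) - u)))"
      by (simp add: u gradient_Ebar[OF E_diff] op_Xi_def op_M_def Ka_def[symmetric] Ka.diff scaleR_diff_right)
    have "(1 / \<sigma>) *\<^sub>R (b - yp) = (1 / \<sigma>) *\<^sub>R (y - yp) + (blinfun_apply K xp + blinfun_apply K (xp - x))"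
      using sigma_pos unfolding b_def by (simp add: scaleR_diff_right scaleR_add_right blinfun.diff_right
          blinfun.add_right scaleR_2)
    then show "snd ((1 / \<tau>) *\<^sub>R (a - xp), (1 / \<sigma>) *\<^sub>R (b - yp))
        = snd (- (gE u + Xi (xp, yp) + M ((xp, yp) - u)))"
      by (simp add: u gradient_Ebar[OF E_diff] op_Xi_def op_M_def scaleR_diff_right)
  qed
  ultimately show ?thesis unfolding forward_backward_def s by simp
qed

text \<open>
  Monotonicity of the subdifferential at \<open>a'\<close> and \<open>b'\<close> together with the skewness of \<open>\<Xi>\<close> leaves the
  gradient terms, whose possible negative part is absorbed by the coercivity of \<open>M - \<Lambda>\<close>.  With
  \<open>b = b'\<close> a solution this is Fejer monotonicity, for general \<open>b\<close> nonexpansiveness of the step.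
\<close>

lemma FB_nonexpansive:
  assumes a: "FB a a'" and b: "FB b b'"
  shows "metric.sq (a' - b') + modulus * (norm ((a' - a) - (b' - b)))\<^sup>2 \<le> metric.sq (a - b)"
proof -
  define w \<delta> where "w = a' - b'" and "\<delta> = (a' - a) - (b' - b)"
  interpret M: bounded_linear M by (rule bounded_linear_M)
  interpret Xi: bounded_linear Xi by (rule bounded_linear_Xi)
  have "0 \<le> inner (- (gE a + Xi a' + M (a' - a)) - - (gE b + Xi b' + M (b' - b))) (a' - b')"
    using a b unfolding forward_backward_def by (rule subdiff_monotone)
  also have "- (gE a + Xi a' + M (a' - a)) - - (gE b + Xi b' + M (b' - b))
      = - (gE a - gE b) - Xi w - M \<delta>"
    unfolding w_def \<delta>_def Xi.diff M.diff by simp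
  finally have "inner (gE a - gE b) w + inner (M \<delta>) w \<le> 0"
    using inner_Xi_self[of w] unfolding w_def[symmetric] by (simp add: inner_diff_left inner_minus_left)
  moreover have "inner (gE a - gE b) w
      = inner (gradient E (fst a) - gradient E (fst b)) (fst a - fst b + fst \<delta>)"
    unfolding gradient_Ebar[OF E_diff] w_def \<delta>_def by (simp add: inner_prod_def)
  ultimately have "2 * inner (M \<delta>) w \<le> L * (norm (fst \<delta>))\<^sup>2"
    using gradient_step_inequality[OF E E_diff E_lip, of "fst \<delta>" "fst a" "fst b"] by simp
  moreover have "metric.sq (a - b) = metric.sq w - 2 * inner (M \<delta>) w + metric.sq \<delta>"
    using metric.sq_diff[of w \<delta>] metric.sym[of w \<delta>] unfolding w_def \<delta>_def by simp
  ultimately show ?thesis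
    using M_minus_Lambda_coercive[of \<delta>] unfolding w_def \<delta>_def by simp
qed

end

section \<open>The correction step\<close>

text \<open>
  By convexity \<open>\<kappa> * \<theta>\<close> times the directional derivative is at most \<open>\<kappa>\<close> times the change of
  \<open>f\<close>.  This leaves the fraction \<open>1 - \<kappa>\<close> of that change on the left-hand side of the line search,
  and the change is at least the inner product of the subgradient with the correction.
\<close>

lemma sufficient_decrease_bound:
  assumes cv: "convex_fun f" and p: "p \<in> subdiff f w"
    and dec: "sufficient_decrease f A W \<epsilon> \<rho> \<kappa> w d \<theta>"
    and pos: "0 \<le> \<theta>" "0 \<le> \<rho>" "0 \<le> \<kappa>" "\<kappa> \<le> 1"
  shows "(op_norm W (\<theta> *\<^sub>R d))\<^sup>2 / (2 * \<epsilon>) \<le> \<rho> / 2 + norm p * norm (\<theta> *\<^sub>R d)"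
proof (cases "\<theta> = 0")
  case True
  then show ?thesis using pos by (simp add: op_norm_def)
next
  case False
  define s where "s = \<theta> *\<^sub>R d"
  have fin: "f (w + s) < \<infinity>"
    and ineq: "f (w + s) + ereal ((op_norm A s)\<^sup>2 / 2) + ereal ((op_norm W s)\<^sup>2 / (2 * \<epsilon>))
      \<le> f w + ereal (\<kappa> * \<theta>) * dir_deriv f w d + ereal (\<rho> / 2)"
    using dec unfolding sufficient_decrease_def s_def by auto
  obtain r where r: "dir_deriv f w d = ereal r"
    "\<theta> * r \<le> real_of_ereal (f (w + s)) - real_of_ereal (f w)"
    using dir_deriv_le_difference[OF cv p _ fin[unfolded s_def]] False pos(1) unfolding s_def
    by (metis less_le)
  obtain a where a: "f w = ereal a" using p unfolding subdiff_def by (cases "f w") auto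
  have sub: "f w + ereal (inner p s) \<le> f (w + s)"
    using p unfolding subdiff_def by (metis (mono_tags, lifting) add_diff_cancel_left' mem_Collect_eq)
  obtain b where b: "f (w + s) = ereal b" using fin sub a by (cases "f (w + s)") auto
  have "b + (op_norm A s)\<^sup>2 / 2 + (op_norm W s)\<^sup>2 / (2 * \<epsilon>) \<le> a + \<kappa> * (\<theta> * r) + \<rho> / 2"
    using ineq unfolding a b r(1) by (simp add: mult.assoc)
  moreover have "\<kappa> * (\<theta> * r) \<le> \<kappa> * (b - a)" using r(2) pos(3) unfolding a b by (intro mult_left_mono) auto
  moreover have "(1 - \<kappa>) * - (norm p * norm s) \<le> (1 - \<kappa>) * (b - a)"
  proof (intro mult_left_mono)
    have "a + inner p s \<le> b" using sub unfolding a b by simp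
    moreover have "\<bar>inner p s\<bar> \<le> norm p * norm s" by (rule Cauchy_Schwarz_ineq2)
    ultimately show "- (norm p * norm s) \<le> b - a" by linarith
  qed (use pos in simp)
  moreover have "0 \<le> \<kappa> * (norm p * norm s)" "0 \<le> (op_norm A s)\<^sup>2 / 2" using pos by simp_all
  ultimately show ?thesis
    unfolding s_def[symmetric] left_diff_distrib right_diff_distrib by linarith
qed

context primal_dual
begin

text \<open>The operator \<open>W\<close> is a positive multiple of \<open>Z Z\<^sup>*\<close>, and \<open>Z\<close> has a bounded right inverse.\<close>

lemma W_coercive: "\<exists>cW>0. \<forall>w. cW * (norm w)\<^sup>2 \<le> (op_norm (op_W \<tau> \<sigma> K) w)\<^sup>2"
proof -
  define Z where "Z = op_Z \<tau> \<sigma> K"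
  define Ka where "Ka = adjoint (blinfun_apply K)"
  define C where "C = const_C \<tau> \<sigma> K"
  have Ka: "bounded_linear Ka" unfolding Ka_def by (rule bounded_linear_K_adjoint)
  interpret Ka: bounded_linear Ka by (rule Ka)
  have "bounded_linear (\<lambda>u. ((1 / \<tau>) *\<^sub>R fst u - 2 *\<^sub>R Ka (snd u), (1 / \<sigma>) *\<^sub>R snd u))"
    by (intro bounded_linear_Pair bounded_linear_sub
        bounded_linear_compose[OF bounded_linear_scaleR_right] bounded_linear_fst bounded_linear_snd
        bounded_linear_compose[OF Ka])
  then have "bounded_linear Z" unfolding Z_def op_Z_def case_prod_beta Ka_def .
  note adj = adjoint_exists[OF this]
  have C: "0 < C"
  proof -
    have "0 \<le> \<tau> * L" using tau_pos L_nonneg by simp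
    then have "(sqrt (\<tau> * \<sigma>) * norm K)\<^sup>2 < 1\<^sup>2"
      using step_lengths tau_pos sigma_pos by (simp add: power_mult_distrib)
    then have "sqrt (\<tau> * \<sigma>) * norm K < 1" by (rule power2_less_imp_less) simp
    then show ?thesis unfolding C_def const_C_def using tau_pos sigma_pos by simp
  qed
  have W: "(op_norm (op_W \<tau> \<sigma> K) w)\<^sup>2 = (norm (adjoint Z w))\<^sup>2 / C" for w
  proof -
    have "inner (op_W \<tau> \<sigma> K w) w = (norm (adjoint Z w))\<^sup>2 / C"
      unfolding op_W_def Z_def[symmetric] C_def[symmetric]
      by (simp add: adj power2_norm_eq_inner)
    then show ?thesis unfolding op_norm_def using C by simp
  qed
  \<comment> \<open>Back substitution in the block triangular operator \<open>Z\<close>.\<close>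
  define S where "S u = (\<tau> *\<^sub>R fst u + (2 * \<tau> * \<sigma>) *\<^sub>R Ka (snd u), \<sigma> *\<^sub>R snd u)" for u
  have "bounded_linear S" unfolding S_def[abs_def]
    by (intro bounded_linear_Pair bounded_linear_add
        bounded_linear_compose[OF bounded_linear_scaleR_right] bounded_linear_fst bounded_linear_snd
        bounded_linear_compose[OF Ka])
  then obtain N where N: "0 < N" "\<And>u. norm (S u) \<le> norm u * N"
    using bounded_linear.pos_bounded by blast
  have ZS: "Z (S u) = u" for u
    using tau_pos sigma_pos unfolding Z_def op_Z_def S_def Ka_def[symmetric]
    by (simp add: Ka.scaleR scaleR_add_right)
  have lower: "norm w \<le> N * norm (adjoint Z w)" for w
  proof -
    have "(norm w)\<^sup>2 = inner (S w) (adjoint Z w)"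
      unfolding adj[symmetric] ZS by (rule power2_norm_eq_inner)
    also have "\<dots> \<le> norm (S w) * norm (adjoint Z w)" by (rule norm_cauchy_schwarz)
    also have "\<dots> \<le> (norm w * N) * norm (adjoint Z w)" by (intro mult_right_mono N) simp
    finally have "norm w * norm w \<le> norm w * (N * norm (adjoint Z w))"
      by (simp add: power2_eq_square mult.assoc)
    then show ?thesis by (cases "w = 0") (use N in auto)
  qed
  have "1 / (N\<^sup>2 * C) * (norm w)\<^sup>2 \<le> (op_norm (op_W \<tau> \<sigma> K) w)\<^sup>2" for w
  proof -
    have "(norm w)\<^sup>2 \<le> N\<^sup>2 * (norm (adjoint Z w))\<^sup>2"
      using power_mono[OF lower[of w], of 2] by (simp add: power_mult_distrib)
    then show ?thesis unfolding W using N C by (simp add: field_simps)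
  qed
  moreover have "0 < 1 / (N\<^sup>2 * C)" using N C by simp
  ultimately show ?thesis by blast
qed

lemma Gbar_add_smooth:
  assumes h: "convex_fun (\<lambda>u. ereal (h u))" and q: "q \<in> subdiff (Gbar F G) w"
    and tangent: "\<And>z. h w + inner g (z - w) \<le> h z"
  shows "convex_fun (\<lambda>u. Gbar F G u + ereal (h u))"
    and "q + g \<in> subdiff (\<lambda>u. Gbar F G u + ereal (h u)) w"
proof -
  show "convex_fun (\<lambda>u. Gbar F G u + ereal (h u))"
    using convex_Gbar h Gbar_not_MInf by (rule convex_fun_add) simp
  obtain a where a: "Gbar F G w = ereal a" using q unfolding subdiff_def by (cases "Gbar F G w") auto
  have "ereal (a + h w) + ereal (inner (q + g) (z - w)) \<le> Gbar F G z + ereal (h z)" for z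
  proof -
    have "ereal a + ereal (inner q (z - w)) + ereal (h w + inner g (z - w)) \<le> Gbar F G z + ereal (h z)"
    proof (rule add_mono)
      have "Gbar F G w + ereal (inner q (z - w)) \<le> Gbar F G z" using q unfolding subdiff_def by blast
      then show "ereal a + ereal (inner q (z - w)) \<le> Gbar F G z" unfolding a .
    qed (use tangent[of z] in simp)
    then show ?thesis by (simp add: inner_add_left algebra_simps)
  qed
  then show "q + g \<in> subdiff (\<lambda>u. Gbar F G u + ereal (h u)) w" unfolding subdiff_def by (simp add: a)
qed

text \<open>
  Both line-search functions add to \<open>Gbar\<close> a convex function with gradient \<open>gE w + Xi w\<close> at \<open>w\<close>.
  The subgradient that the inclusion for \<open>w\<close> provides is therefore small when \<open>w\<close> is close to \<open>u\<close>.
\<close>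

lemma line_search_bound:
  assumes fb: "FB u w"
    and dec: "sufficient_decrease (Phi F E G K w) A W \<epsilon> \<rho> \<kappa> w d \<theta> \<or>
      sufficient_decrease (Psi F E G K w) A' W \<epsilon> \<rho> \<kappa> w d \<theta>"
    and pos: "0 \<le> \<theta>" "0 \<le> \<rho>" "0 \<le> \<kappa>" "\<kappa> \<le> 1"
  shows "(op_norm W (\<theta> *\<^sub>R d))\<^sup>2 / (2 * \<epsilon>)
    \<le> \<rho> / 2 + norm (gE w - gE u - M (w - u)) * norm (\<theta> *\<^sub>R d)"
proof -
  define q g where "q = - (gE u + Xi w + M (w - u))" and "g = gE w + Xi w"
  define e where "e u = real_of_ereal (Ebar E u)" for u :: "'x \<times> 'y"
  have q: "q \<in> subdiff (Gbar F G) w" using fb unfolding forward_backward_def q_def .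
  have qg: "q + g = gE w - gE u - M (w - u)" unfolding q_def g_def by simp
  have e: "Ebar E u = ereal (e u)" for u
    using E_diff unfolding differentiable_fun_def e_def Ebar_def by (cases u) (simp add: ereal_real')
  have e_tangent: "e w + inner (gE w) (z - w) \<le> e z" for z
    using gradient_inequality[OF E E_diff, of "fst w" "fst z"]
    unfolding gradient_Ebar[OF E_diff] by (simp add: e_def Ebar_def inner_prod_def case_prod_beta)
  have "convex_fun (Ebar E)"
    using convex_fun_compose_linear[OF E linear_fst] unfolding Ebar_def case_prod_beta .
  then have e_convex: "convex_fun (\<lambda>u. ereal (e u))" unfolding e[symmetric] .
  from dec show ?thesis
  proof
    define h where "h u = e u + inner (Xi w) u" for u
    have "convex_fun (\<lambda>u. ereal (e u) + ereal (inner (Xi w) u + 0))"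
      using e_convex convex_fun_affine by (rule convex_fun_add) auto
    then have h: "convex_fun (\<lambda>u. ereal (h u))" by (simp add: h_def)
    have "h w + inner g (z - w) \<le> h z" for z
      using e_tangent[of z] unfolding h_def g_def by (simp add: inner_add_left inner_diff_right)
    note add = Gbar_add_smooth[OF h q this]
    have "Phi F E G K w = (\<lambda>u. Gbar F G u + ereal (h u))"
      by (rule ext) (simp add: Phi_def e h_def add.assoc)
    moreover assume "sufficient_decrease (Phi F E G K w) A W \<epsilon> \<rho> \<kappa> w d \<theta>"
    ultimately show ?thesis using sufficient_decrease_bound[OF add _ pos] unfolding qg by simp
  next
    define h where "h u = inner g u + (e w - inner (gE w) w)" for u
    have h: "convex_fun (\<lambda>u. ereal (h u))" unfolding h_def by (rule convex_fun_affine)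
    have "h w + inner g (z - w) \<le> h z" for z unfolding h_def by (simp add: inner_diff_right)
    note add = Gbar_add_smooth[OF h q this]
    have "Psi F E G K w u = Gbar F G u + ereal (h u)" for u
      by (cases "Gbar F G u")
        (simp_all add: Psi_def e h_def g_def inner_add_left inner_diff_right)
    then have "Psi F E G K w = (\<lambda>u. Gbar F G u + ereal (h u))" by (rule ext)
    moreover assume "sufficient_decrease (Psi F E G K w) A' W \<epsilon> \<rho> \<kappa> w d \<theta>"
    ultimately show ?thesis using sufficient_decrease_bound[OF add _ pos] unfolding qg by simp
  qed
qed

text \<open>
  By Young's inequality the line search makes the squared length of the correction of the order
  \<open>\<epsilon> * (\<rho> + \<epsilon> * (norm (w - u))\<^sup>2)\<close>.  Adding such a correction to a nonexpansive step, with weight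
  \<open>1 + 1 / \<epsilon>\<close>, costs a relative error \<open>\<epsilon>\<close> and an absolute error \<open>\<rho>\<close>, up to a constant.
\<close>

lemma corrected_step_bound:
  fixes \<epsilon>max :: real
  shows "\<exists>C\<ge>0. \<forall>u w p d \<theta> \<epsilon> \<rho> \<kappa> A A'.
    FB u w \<longrightarrow> p \<in> solutions \<longrightarrow> 0 \<le> \<theta> \<longrightarrow> 0 < \<epsilon> \<longrightarrow> \<epsilon> \<le> \<epsilon>max \<longrightarrow> 0 \<le> \<rho> \<longrightarrow> 0 \<le> \<kappa> \<longrightarrow> \<kappa> \<le> 1 \<longrightarrow>
    sufficient_decrease (Phi F E G K w) A (op_W \<tau> \<sigma> K) \<epsilon> \<rho> \<kappa> w d \<theta> \<or>
    sufficient_decrease (Psi F E G K w) A' (op_W \<tau> \<sigma> K) \<epsilon> \<rho> \<kappa> w d \<theta> \<longrightarrow>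
    metric.sq (w + \<theta> *\<^sub>R d - p)
      \<le> (1 + C * \<epsilon>) * metric.sq (u - p) + C * \<rho> - modulus * (norm (w - u))\<^sup>2"
proof -
  obtain cW where cW: "0 < cW" "\<And>w. cW * (norm w)\<^sup>2 \<le> (op_norm (op_W \<tau> \<sigma> K) w)\<^sup>2"
    using W_coercive by blast
  obtain N where N: "0 < N" "\<And>x. metric.sq x \<le> N * (norm x)\<^sup>2" using metric.sq_upper by blast
  obtain NM where NM: "0 < NM" "\<And>x. norm (M x) \<le> norm x * NM"
    using bounded_linear.pos_bounded[OF bounded_linear_M] by blast
  define C1 where "C1 = L + NM"
  define Q where "Q = N * (1 + \<epsilon>max) * (4 / cW)"
  define C where "C = 1 + \<bar>Q\<bar> * (1 / 2 + C1\<^sup>2 / (cW * modulus))"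
  have C1: "0 \<le> C1" unfolding C1_def using L_nonneg NM by simp
  have "0 \<le> C" unfolding C_def using cW modulus_pos by (intro add_nonneg_nonneg mult_nonneg_nonneg) auto
  moreover have "metric.sq (w + \<theta> *\<^sub>R d - p)
      \<le> (1 + C * \<epsilon>) * metric.sq (u - p) + C * \<rho> - modulus * (norm (w - u))\<^sup>2"
    if fb: "FB u w" and p: "p \<in> solutions" and pos: "0 \<le> \<theta>" "0 < \<epsilon>" "\<epsilon> \<le> \<epsilon>max" "0 \<le> \<rho>" "0 \<le> \<kappa>" "\<kappa> \<le> 1"
      and dec: "sufficient_decrease (Phi F E G K w) A (op_W \<tau> \<sigma> K) \<epsilon> \<rho> \<kappa> w d \<theta> \<or>
        sufficient_decrease (Psi F E G K w) A' (op_W \<tau> \<sigma> K) \<epsilon> \<rho> \<kappa> w d \<theta>"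
    for u w p d \<theta> \<epsilon> \<rho> \<kappa> A A'
  proof -
    define s where "s = norm (\<theta> *\<^sub>R d)"
    define P where "P = norm (gE w - gE u - M (w - u))"
    define a where "a = metric.sq (u - p)"
    define n where "n = (norm (w - u))\<^sup>2"
    have fejer: "metric.sq (w - p) + modulus * n \<le> a"
      using FB_nonexpansive[OF fb, of p p] p unfolding solutions_iff a_def n_def by simp
    have n: "0 \<le> n" unfolding n_def by simp
    have n_le: "n \<le> a / modulus"
      using fejer metric.sq_nonneg[of "w - p"] modulus_pos by (simp add: field_simps)
    have a: "0 \<le> a" unfolding a_def by (rule metric.sq_nonneg)
    have "norm (gE w - gE u) \<le> L * norm (w - u)"
    proof -
      have "norm (gE w - gE u) = dist (gradient E (fst w)) (gradient E (fst u))"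
        unfolding gradient_Ebar[OF E_diff] dist_norm by (simp add: norm_Pair)
      also have "\<dots> \<le> L * dist (fst w) (fst u)" by (rule lipschitz_onD[OF E_lip]) auto
      also have "\<dots> \<le> L * norm (w - u)"
        using dist_fst_le[of w u] L_nonneg unfolding dist_norm by (rule mult_left_mono)
      finally show ?thesis .
    qed
    then have "P \<le> C1 * norm (w - u)"
      using norm_triangle_ineq4[of "gE w - gE u" "M (w - u)"] NM(2)[of "w - u"]
      unfolding P_def C1_def by (simp add: algebra_simps)
    then have "P\<^sup>2 \<le> (C1 * norm (w - u))\<^sup>2" unfolding P_def by (intro power_mono) auto
    also have "\<dots> = C1\<^sup>2 * n" unfolding n_def by (simp add: power_mult_distrib)
    also have "\<dots> \<le> C1\<^sup>2 * (a / modulus)" by (intro mult_left_mono n_le) simp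
    finally have P2: "P\<^sup>2 \<le> C1\<^sup>2 * (a / modulus)" .
    have "cW * s\<^sup>2 / (2 * \<epsilon>) \<le> (op_norm (op_W \<tau> \<sigma> K) (\<theta> *\<^sub>R d))\<^sup>2 / (2 * \<epsilon>)"
      using cW(2)[of "\<theta> *\<^sub>R d"] pos unfolding s_def by (intro divide_right_mono) auto
    also have "\<dots> \<le> \<rho> / 2 + P * s"
      unfolding P_def s_def using line_search_bound[OF fb dec] pos by simp
    finally have s1: "cW * s\<^sup>2 / (2 * \<epsilon>) \<le> \<rho> / 2 + P * s" .
    have "0 \<le> (cW * s - 2 * \<epsilon> * P)\<^sup>2 / (4 * \<epsilon> * cW)" using cW pos by simp
    also have "\<dots> = cW * s\<^sup>2 / (4 * \<epsilon>) - P * s + \<epsilon> * P\<^sup>2 / cW"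
      using cW pos by (simp add: power2_diff field_simps power2_eq_square)
    also have "cW * s\<^sup>2 / (4 * \<epsilon>) = cW * s\<^sup>2 / (2 * \<epsilon>) - cW * s\<^sup>2 / (4 * \<epsilon>)" by simp
    finally have "cW * s\<^sup>2 / (4 * \<epsilon>) \<le> \<rho> / 2 + \<epsilon> * P\<^sup>2 / cW" using s1 by linarith
    also have "\<dots> \<le> \<rho> / 2 + \<epsilon> * (C1\<^sup>2 * (a / modulus)) / cW"
      using cW pos P2 by (intro add_left_mono divide_right_mono mult_left_mono) auto
    finally have "(4 / cW) * (cW * s\<^sup>2 / (4 * \<epsilon>))
        \<le> (4 / cW) * (\<rho> / 2 + \<epsilon> * (C1\<^sup>2 * (a / modulus)) / cW)"
      using cW by (intro mult_left_mono) auto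
    also have "(4 / cW) * (cW * s\<^sup>2 / (4 * \<epsilon>)) = s\<^sup>2 / \<epsilon>" using cW by simp
    finally have "s\<^sup>2 / \<epsilon> \<le> (4 / cW) * (\<rho> / 2 + \<epsilon> * (C1\<^sup>2 * (a / modulus)) / cW)" .
    then have "(N * (1 + \<epsilon>)) * (s\<^sup>2 / \<epsilon>) \<le> (N * (1 + \<epsilon>max)) * ((4 / cW) * (\<rho> / 2 + \<epsilon> * (C1\<^sup>2 * (a / modulus)) / cW))"
      using pos N by (intro mult_mono) auto
    also have "\<dots> = Q * (\<rho> / 2 + \<epsilon> * (C1\<^sup>2 * (a / modulus)) / cW)" unfolding Q_def by simp
    also have "\<dots> = \<rho> * (Q * (1 / 2)) + (\<epsilon> * a) * (Q * (C1\<^sup>2 / (cW * modulus)))"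
      using cW modulus_pos by (simp add: field_simps)
    also have "\<dots> \<le> \<rho> * C + (\<epsilon> * a) * (C - 1)"
    proof (intro add_mono mult_left_mono)
      have x: "0 \<le> C1\<^sup>2 / (cW * modulus)" using cW modulus_pos by simp
      then have y: "0 \<le> \<bar>Q\<bar> * (C1\<^sup>2 / (cW * modulus))"
        by (intro mult_nonneg_nonneg) simp_all
      have "Q * (C1\<^sup>2 / (cW * modulus)) \<le> \<bar>Q\<bar> * (C1\<^sup>2 / (cW * modulus))"
        using x by (intro mult_right_mono) auto
      then show "Q * (C1\<^sup>2 / (cW * modulus)) \<le> C - 1" unfolding C_def by (simp add: distrib_left)
      show "Q * (1 / 2) \<le> C" using y unfolding C_def distrib_left by linarith
    qed (use pos a in auto)
    finally have corr: "(N * (1 + \<epsilon>)) * (s\<^sup>2 / \<epsilon>) \<le> \<rho> * C + (\<epsilon> * a) * (C - 1)" .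
    have "metric.sq ((w - p) + \<theta> *\<^sub>R d)
        \<le> (1 + \<epsilon>) * metric.sq (w - p) + (1 + 1 / \<epsilon>) * metric.sq (\<theta> *\<^sub>R d)"
      by (rule metric.sq_young[OF pos(2)])
    also have "\<dots> \<le> (1 + \<epsilon>) * (a - modulus * n) + (1 + 1 / \<epsilon>) * (N * s\<^sup>2)"
      using fejer N(2)[of "\<theta> *\<^sub>R d"] pos unfolding s_def by (intro add_mono mult_left_mono) auto
    also have "(1 + 1 / \<epsilon>) * (N * s\<^sup>2) = (N * (1 + \<epsilon>)) * (s\<^sup>2 / \<epsilon>)"
      using pos by (simp add: field_simps)
    also have "(1 + \<epsilon>) * (a - modulus * n) + \<dots>
        \<le> (1 + \<epsilon>) * a - modulus * n + (\<rho> * C + (\<epsilon> * a) * (C - 1))"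
      using corr pos n modulus_pos by (intro add_mono) (auto simp: algebra_simps)
    also have "\<dots> = (1 + C * \<epsilon>) * a + C * \<rho> - modulus * n" by (simp add: algebra_simps)
    finally show ?thesis unfolding a_def n_def by (simp add: algebra_simps)
  qed
  ultimately show ?thesis by blast
qed

text \<open>
  With summable errors the squared distances to each solution are bounded, hence quasi-decreasing;
  the steps then become short, and nonexpansiveness gives weak convergence.
\<close>

lemma perturbed_iteration_converges:
  fixes e r :: "nat \<Rightarrow> real"
  assumes nonneg: "\<And>k. 0 \<le> e k" "\<And>k. 0 \<le> r k" and sums: "summable e" "summable r" and C: "0 \<le> C"
    and bound: "\<And>k p. p \<in> solutions \<Longrightarrow> metric.sq (u (Suc k) - p)
      \<le> (1 + C * e k) * metric.sq (u k - p) + C * r k - modulus * (norm (step (u k) - u k))\<^sup>2"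
  shows "quasi_fejer M solutions u \<and> (\<exists>p\<in>solutions. weakly_converges u p)"
proof -
  define b where "b k = modulus * (norm (step (u k) - u k))\<^sup>2" for k
  have b: "0 \<le> b k" for k unfolding b_def using modulus_pos by simp
  have rec: "\<exists>A \<gamma>. (\<forall>k. metric.sq (u k - p) \<le> A) \<and> (\<forall>k. 0 \<le> \<gamma> k) \<and> summable \<gamma> \<and>
      (\<forall>k. metric.sq (u (Suc k) - p) \<le> metric.sq (u k - p) + \<gamma> k - b k)"
    if p: "p \<in> solutions" for p
  proof -
    have "metric.sq (u (Suc k) - p) \<le> (1 + C * e k) * metric.sq (u k - p) + C * r k" for k
      using bound[OF p, of k] b[of k] unfolding b_def by linarith
    then obtain A where A: "\<And>k. metric.sq (u k - p) \<le> A"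
      using gronwall_bounded[of "\<lambda>k. metric.sq (u k - p)" "\<lambda>k. C * e k" "\<lambda>k. C * r k"]
        metric.sq_nonneg C nonneg sums summable_mult by (metis mult_nonneg_nonneg)
    then have A0: "0 \<le> A" using metric.sq_nonneg order_trans by blast
    define \<gamma> where "\<gamma> k = C * A * e k + C * r k" for k
    have "metric.sq (u (Suc k) - p) \<le> metric.sq (u k - p) + \<gamma> k - b k" for k
    proof -
      have "C * e k * metric.sq (u k - p) \<le> C * e k * A" using C nonneg A by (intro mult_left_mono) auto
      then show ?thesis using bound[OF p, of k] unfolding \<gamma>_def b_def by (simp add: algebra_simps)
    qed
    moreover have "0 \<le> \<gamma> k" for k unfolding \<gamma>_def using C A0 nonneg by simp
    moreover have "summable \<gamma>" unfolding \<gamma>_def by (intro summable_add summable_mult sums)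
    ultimately show ?thesis using A by blast
  qed
  have op_norm: "(op_norm M x)\<^sup>2 = metric.sq x" for x
    unfolding op_norm_def using metric.sq_nonneg by simp
  have "quasi_fejer M solutions u"
    unfolding quasi_fejer_def op_norm
  proof
    fix p assume "p \<in> solutions"
    then obtain \<gamma> where \<gamma>: "\<And>k. 0 \<le> \<gamma> k" "summable \<gamma>"
      "\<And>k. metric.sq (u (Suc k) - p) \<le> metric.sq (u k - p) + \<gamma> k - b k" using rec by blast
    then have "metric.sq (u (Suc k) - p) \<le> metric.sq (u k - p) + \<gamma> k" for k
      using b[of k] by (smt (verit))
    \<comment> \<open>Only the values at successors matter in the definition, hence the shift.\<close>
    then show "\<exists>\<gamma>. (\<forall>k. 0 \<le> \<gamma> (Suc k)) \<and> summable (\<lambda>k. \<gamma> (Suc k)) \<and>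
        (\<forall>k. metric.sq (u (Suc k) - p) \<le> metric.sq (u k - p) + \<gamma> (Suc k))"
      using \<gamma>(1,2) by (intro exI[of _ "\<lambda>k. \<gamma> (k - 1)"]) simp
  qed
  moreover have "\<exists>p\<in>solutions. weakly_converges u p"
  proof -
    obtain p where p: "p \<in> solutions" using solvable by blast
    obtain A \<gamma> where A: "\<And>k. metric.sq (u k - p) \<le> A" and \<gamma>: "\<And>k. 0 \<le> \<gamma> k" "summable \<gamma>"
      "\<And>k. metric.sq (u (Suc k) - p) \<le> metric.sq (u k - p) + \<gamma> k - b k" using rec[OF p] by blast
    have "b \<longlonglongrightarrow> 0"
      by (rule quasi_decreasing_convergent(2)[OF metric.sq_nonneg b \<gamma>])
    then have "(\<lambda>k. sqrt (b k / modulus)) \<longlonglongrightarrow> sqrt (0 / modulus)"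
      by (intro tendsto_intros) (use modulus_pos in auto)
    then have "(\<lambda>k. norm (u k - step (u k))) \<longlonglongrightarrow> 0"
      using modulus_pos unfolding b_def by (simp add: norm_minus_commute)
    then have regular: "(\<lambda>k. u k - step (u k)) \<longlonglongrightarrow> 0" by (rule tendsto_norm_zero_cancel)
    have "norm (u k) \<le> sqrt (A / modulus) + norm p" for k
    proof -
      have "(norm (u k - p))\<^sup>2 \<le> A / modulus"
        using metric.coercive[of "u k - p"] A[of k] modulus_pos by (simp add: field_simps)
      then have "norm (u k - p) \<le> sqrt (A / modulus)" by (rule real_le_rsqrt)
      then show ?thesis using norm_triangle_ineq2[of "u k" p] by linarith
    qed
    moreover have "metric.sq (step x - step y) \<le> metric.sq (x - y)" for x y
      using FB_nonexpansive[OF step_forward_backward[of x] step_forward_backward[of y]] modulus_pos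
        mult_nonneg_nonneg[OF less_imp_le[OF modulus_pos] zero_le_power2[of "norm (step x - x - (step y - y))"]]
      by linarith
    moreover have "x \<in> solutions" if "step x = x" for x
      using step_forward_backward[of x] that unfolding solutions_iff by simp
    moreover have "convergent (\<lambda>k. metric.sq (u k - p))" if p: "p \<in> solutions" for p
    proof -
      obtain \<gamma> where \<gamma>: "\<And>k. 0 \<le> \<gamma> k" "summable \<gamma>"
        "\<And>k. metric.sq (u (Suc k) - p) \<le> metric.sq (u k - p) + \<gamma> k - b k" using rec[OF p] by blast
      show ?thesis by (rule quasi_decreasing_convergent(1)[OF metric.sq_nonneg b \<gamma>])
    qed
    ultimately show ?thesis using metric.weakly_converges_to_fixed_point[OF _ regular] by blast
  qed
  ultimately show ?thesis by blast
qed

end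

section \<open>Convergence of the corrected algorithm\<close>

theorem theorem6p7:
  fixes F E :: "'x::{real_inner,complete_space} \<Rightarrow> ereal"
    and G :: "'y::{real_inner,complete_space} \<Rightarrow> ereal"
    and K :: "'x \<Rightarrow>\<^sub>L 'y"
    and L \<tau> \<sigma> :: real
    and FH :: "nat \<Rightarrow> 'xh::{real_inner,complete_space} \<Rightarrow> ereal"
    and EH :: "'xh \<Rightarrow> real"
    and GH :: "nat \<Rightarrow> 'yh::{real_inner,complete_space} \<Rightarrow> ereal"
    and KH :: "'xh \<Rightarrow>\<^sub>L 'yh"
    and LH \<tau>H \<sigma>H :: real
    and P :: "'x \<Rightarrow>\<^sub>L 'xh" and D :: "'y \<Rightarrow>\<^sub>L 'yh"
    and \<epsilon> \<rho> :: "nat \<Rightarrow> real"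
    and \<kappa> vartheta :: real and m :: nat and I :: "nat set"
    and u0 :: "'x \<times> 'y" and u :: "nat \<Rightarrow> 'x \<times> 'y"
    and v :: "nat \<Rightarrow> nat \<Rightarrow> 'xh \<times> 'yh"
    and d :: "nat \<Rightarrow> 'x \<times> 'y" and \<theta> :: "nat \<Rightarrow> real"
  assumes fine: "pd_structure F E G L K \<tau> \<sigma>"
    and coarse: "\<forall>k\<in>I. pd_structure (FH k) (\<lambda>z. ereal (EH z)) (GH k) LH KH \<tau>H \<sigma>H"
    and coherence: "\<forall>k\<in>I. coherent F G (FH k) (GH k) P D (pdps_step F E G K \<tau> \<sigma> (u k))"
    and params_pos: "\<forall>k\<in>I. 0 < \<epsilon> k \<and> 0 < \<rho> k"
    and params_sum: "\<epsilon> summable_on I" "\<rho> summable_on I"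
    and params_prod: "convergent_prod (\<lambda>k. if k \<in> I then 1 + \<epsilon> k else 1)"
    and kappa: "0 < \<kappa>" "\<kappa> < 1"
    and inner_its: "1 \<le> m"
    and theta_choice: "vartheta \<in> {0, 1}"
    and nonempty: "pd_solutions F E G K \<noteq> {}"
    and algorithm:
      "pdmcc F E G L K \<tau> \<sigma> FH EH GH KH \<tau>H \<sigma>H P D \<epsilon> \<rho> \<kappa> m vartheta I u0 u v d \<theta>"
  shows "quasi_fejer (op_M \<tau> \<sigma> K) (pd_solutions F E G K) u \<and>
         (\<exists>uhat\<in>pd_solutions F E G K. weakly_converges u uhat)"
proof -
  interpret primal_dual F E G K L \<tau> \<sigma> by unfold_locales (rule fine nonempty)+
  define e r where "e k = (if k \<in> I then \<epsilon> k else 0)" and "r k = (if k \<in> I then \<rho> k else 0)" for k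
  have nonneg: "0 \<le> e k" "0 \<le> r k" for k
    using params_pos unfolding e_def r_def by (auto simp: less_imp_le)
  have sums: "summable e" "summable r"
    unfolding e_def[abs_def] r_def[abs_def]
    by (rule summable_if_summable_on, fact params_sum, use params_pos in \<open>force simp: less_imp_le\<close>)+
  \<comment> \<open>The sum of the series bounds every \<open>\<epsilon> k\<close>, which makes the constant independent of \<open>k\<close>.\<close>
  obtain C where C: "0 \<le> C" and bound: "\<And>u w p d \<theta> \<epsilon> \<rho> \<kappa> A A'.
    FB u w \<Longrightarrow> p \<in> solutions \<Longrightarrow> 0 \<le> \<theta> \<Longrightarrow> 0 < \<epsilon> \<Longrightarrow> \<epsilon> \<le> suminf e \<Longrightarrow> 0 \<le> \<rho> \<Longrightarrow> 0 \<le> \<kappa> \<Longrightarrow> \<kappa> \<le> 1 \<Longrightarrow>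
    sufficient_decrease (Phi F E G K w) A (op_W \<tau> \<sigma> K) \<epsilon> \<rho> \<kappa> w d \<theta> \<or>
    sufficient_decrease (Psi F E G K w) A' (op_W \<tau> \<sigma> K) \<epsilon> \<rho> \<kappa> w d \<theta> \<Longrightarrow>
    metric.sq (w + \<theta> *\<^sub>R d - p)
      \<le> (1 + C * \<epsilon>) * metric.sq (u - p) + C * \<rho> - modulus * (norm (w - u))\<^sup>2"
    using corrected_step_bound[of "suminf e"] by blast
  note alg = algorithm[unfolded pdmcc_def Let_def, THEN conjunct2, rule_format]
  have "metric.sq (u (Suc k) - p)
      \<le> (1 + C * e k) * metric.sq (u k - p) + C * r k - modulus * (norm (step (u k) - u k))\<^sup>2"
    if p: "p \<in> solutions" for k p
  proof -
    have "metric.sq (step (u k) - p) + modulus * (norm (step (u k) - u k))\<^sup>2 \<le> metric.sq (u k - p)"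
      using FB_nonexpansive[OF step_forward_backward[of "u k"], of p p] p unfolding solutions_iff by simp
    moreover have "0 \<le> C * e k * metric.sq (u k - p)" "0 \<le> C * r k"
      using C nonneg metric.sq_nonneg by simp_all
    ultimately have uncorrected: "metric.sq (step (u k) - p)
        \<le> (1 + C * e k) * metric.sq (u k - p) + C * r k - modulus * (norm (step (u k) - u k))\<^sup>2"
      by (simp add: algebra_simps)
    consider (pure) "u (Suc k) = step (u k)"
      | (corrected) "k \<in> I" "u (Suc k) = step (u k) + \<theta> k *\<^sub>R d k" "0 \<le> \<theta> k"
        "sufficient_decrease (Phi F E G K (step (u k))) M (op_W \<tau> \<sigma> K) (\<epsilon> k) (\<rho> k) \<kappa> (step (u k)) (d k) (\<theta> k) \<or>
         sufficient_decrease (Psi F E G K (step (u k))) (\<lambda>w. M w + op_Lambda L w) (op_W \<tau> \<sigma> K)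
           (\<epsilon> k) (\<rho> k) \<kappa> (step (u k)) (d k) (\<theta> k)"
    proof (cases "k \<in> I")
      case False
      then show ?thesis using alg[of k] pure by simp
    next
      case True
      show ?thesis
      proof (cases "\<theta> k = 0")
        case \<theta>: True
        then show ?thesis using alg[of k] True pure by simp
      next
        case False
        show ?thesis
          by (rule corrected) (use alg[of k, unfolded if_bool_eq_disj] True False in blast)+
      qed
    qed
    then show ?thesis
    proof cases
      case pure
      then show ?thesis using uncorrected by simp
    next
      case corrected
      have "e k \<le> suminf e"
        using sum_le_suminf[OF sums(1), of "{k}"] nonneg by simp
      then show ?thesis
        using bound[OF step_forward_backward p corrected(3) _ _ _ _ _ corrected(4)]
          params_pos corrected(1,2) kappa unfolding e_def r_def by (simp add: less_imp_le)
    qed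
  qed
  then show ?thesis by (intro perturbed_iteration_converges[OF nonneg sums C]) blast
qed

end
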